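(* Let $d\in\{1,2,\ldots\}$ and let $C_d\subset\mathrm{Hol}_d(S^2,\mathbb{C}P^1)$ be the set of collapse points. Then $C_d$ is non-empty if and only if $d\ge3$, in which case it is a non-empty proper algebraic subvariety of $\mathrm{Hol}_d(S^2,\mathbb{C}P^1)$.
   Context: $S^2$ is identified with $\mathbb{C}\cup\{\infty\}$. Any $f\in\mathrm{Hol}_d(S^2,\mathbb{C}P^1)$ (holomorphic maps of degree $d$) is written $f=[F_0,F_2]$ with $F_0,F_2$ coprime polynomials of maximum degree exactly $d$; this identifies $\mathrm{Hol}_d(S^2,\mathbb{C}P^1)$ with an open dense subset of the projective space $P(\mathbb{C}[z]_d^2)\cong\mathbb{C}P^{2d+1}$, where $\mathbb{C}[z]_d$ is the space of polynomials of degree $\le d$. The map $f=[F_0,F_2]$ is identified with the map $[F_0,0,F_2,0]:S^2\to\mathbb{C}P^3$. A holomorphic map $f=[F_0,F_1,F_2,F_3]:S^2\to\mathbb{C}P^3$ ($F_i$ polynomials) is horizontal (for the twistor fibration $\mathbb{C}P^3\to\mathbb HP^1= S^4$) if $F_1F_0'-F_0F_1'+F_3F_2'-F_2F_3'=0$. It is full if its image lies in no projective subspace $\mathbb{C}P^2$. A map $f=[F_0,F_2]\in\mathrm{Hol}_d(S^2,\mathbb{C}P^1)$ is a collapse point if $[F_0,0,F_2,0]$ lies in the closure, in the space of horizontal holomorphic maps $S^2\to\mathbb{C}P^3$ of degree $d$ (compact-open topology), of the subspace of full ones. *)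

theory Defs
  imports
    "HOL-Analysis.Analysis"
    "HOL-Computational_Algebra.Computational_Algebra"
    "HOL-Library.Poly_Mapping"
begin

(* Points of complex projective space are complex lines through 0 in complex^'n, so that
   complex^2 gives CP^1 and complex^4 gives CP^3.  The numeral types 2 and 4 consist of
   0,1 and 0,1,2,3, hence homogeneous coordinates are numbered from 0. *)

definition cp_points :: "(complex ^ 'n) set set" where
  "cp_points = {L. vec.subspace L \<and> vec.dim L = 1}"

(* The quotient topology of the map sending v \<noteq> 0 to the line it spans. *)
definition cp_top :: "(complex ^ 'n) set topology" where
  "cp_top = topology (\<lambda>U. U \<subseteq> cp_points \<and> open {v. v \<noteq> 0 \<and> vec.span {v} \<in> U})"

lemma openin_cp_top:
  fixes U :: "(complex ^ 'n) set set"
  shows "openin cp_top U \<longleftrightarrow> U \<subseteq> cp_points \<and> open {v. v \<noteq> 0 \<and> vec.span {v} \<in> U}"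
proof -
  have "istopology (\<lambda>U :: (complex ^ 'n) set set.
          U \<subseteq> cp_points \<and> open {v. v \<noteq> 0 \<and> vec.span {v} \<in> U})"
    unfolding istopology_def
  proof (intro conjI allI impI)
    fix S T :: "(complex ^ 'n) set set"
    assume S: "S \<subseteq> cp_points \<and> open {v. v \<noteq> 0 \<and> vec.span {v} \<in> S}"
      and T: "T \<subseteq> cp_points \<and> open {v. v \<noteq> 0 \<and> vec.span {v} \<in> T}"
    have "{v. v \<noteq> 0 \<and> vec.span {v} \<in> S \<inter> T} =
        {v. v \<noteq> 0 \<and> vec.span {v} \<in> S} \<inter> {v. v \<noteq> 0 \<and> vec.span {v} \<in> T}"
      by auto
    then show "open {v. v \<noteq> 0 \<and> vec.span {v} \<in> S \<inter> T}"
      using S T by (simp add: open_Int)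
    show "S \<inter> T \<subseteq> cp_points"
      using S by auto
  next
    fix \<U> :: "(complex ^ 'n) set set set"
    assume *: "\<forall>U\<in>\<U>. U \<subseteq> cp_points \<and> open {v. v \<noteq> 0 \<and> vec.span {v} \<in> U}"
    have "{v. v \<noteq> 0 \<and> vec.span {v} \<in> \<Union>\<U>} = (\<Union>U\<in>\<U>. {v. v \<noteq> 0 \<and> vec.span {v} \<in> U})"
      by auto
    then show "open {v. v \<noteq> 0 \<and> vec.span {v} \<in> \<Union>\<U>}"
      using * by (simp add: open_UN)
    show "\<Union>\<U> \<subseteq> cp_points"
      using * by auto
  qed
  then show ?thesis
    by (simp add: cp_top_def topology_inverse')
qed

(* The sphere is the one-point compactification of the plane; None is the point at infinity. *)
definition sphere2 :: "complex option topology" where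
  "sphere2 = Alexandroff_compactification euclidean"

definition compact_open :: "'a topology \<Rightarrow> 'b topology \<Rightarrow> ('a \<Rightarrow> 'b) topology" where
  "compact_open X Y = topology_generated_by
     {{f. continuous_map X Y f \<and> f ` K \<subseteq> U} | K U. compactin X K \<and> openin Y U}"

definition max_degree :: "complex poly ^ 'n \<Rightarrow> nat" where
  "max_degree F = Max (range (\<lambda>i. Polynomial.degree (F $ i)))"

definition coprime_tuple :: "complex poly ^ 'n \<Rightarrow> bool" where
  "coprime_tuple F \<longleftrightarrow> (\<forall>p. (\<forall>i. p dvd F $ i) \<longrightarrow> is_unit p)"

(* The map z \<mapsto> [F_0(z), F_1(z), ...].  At infinity its value is the limit of
   [z^{-m} F_0(z), z^{-m} F_1(z), ...], where m is the maximum degree. *)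
definition proj_map :: "complex poly ^ 'n \<Rightarrow> complex option \<Rightarrow> (complex ^ 'n) set" where
  "proj_map F p = (case p of
      Some z \<Rightarrow> vec.span {\<chi> i. poly (F $ i) z}
    | None \<Rightarrow> vec.span {\<chi> i. coeff (F $ i) (max_degree F)})"

definition poly_tuples :: "nat \<Rightarrow> (complex poly ^ 'n) set" where
  "poly_tuples d = {F. coprime_tuple F \<and> max_degree F = d}"

(* Holomorphic maps of degree d from the sphere to projective space, described through their
   presentations by coprime polynomials of maximum degree exactly d. *)
definition Hol :: "nat \<Rightarrow> (complex option \<Rightarrow> (complex ^ 'n) set) set" where
  "Hol d = proj_map ` poly_tuples d"

definition horizontal_tuple :: "complex poly ^ 4 \<Rightarrow> bool" where
  "horizontal_tuple F \<longleftrightarrow>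
     F $ 1 * pderiv (F $ 0) - F $ 0 * pderiv (F $ 1)
       + F $ 3 * pderiv (F $ 2) - F $ 2 * pderiv (F $ 3) = 0"

definition horizontal_Hol :: "nat \<Rightarrow> (complex option \<Rightarrow> (complex ^ 4) set) set" where
  "horizontal_Hol d = {proj_map F | F. F \<in> poly_tuples d \<and> horizontal_tuple F}"

definition full :: "(complex option \<Rightarrow> (complex ^ 4) set) \<Rightarrow> bool" where
  "full f \<longleftrightarrow> \<not> (\<exists>W. vec.subspace W \<and> vec.dim W = 3 \<and> (\<forall>p. f p \<subseteq> W))"

(* The embedding [x, y] \<mapsto> [x, 0, y, 0] of CP^1 into CP^3, on lines. *)
definition cp_embed :: "(complex ^ 2) set \<Rightarrow> (complex ^ 4) set" where
  "cp_embed L = (\<lambda>v. \<chi> i. if i = 0 then v $ 0 else if i = 2 then v $ 1 else 0) ` L"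

definition collapse_points :: "nat \<Rightarrow> (complex option \<Rightarrow> (complex ^ 2) set) set" where
  "collapse_points d = {f \<in> Hol d. cp_embed \<circ> f \<in>
     (subtopology (compact_open sphere2 cp_top) (horizontal_Hol d))
       closure_of {g \<in> horizontal_Hol d. full g}}"

(* Multivariate polynomials are finitely supported functions from monomials to coefficients,
   and monomials are finitely supported functions from variables to exponents. *)
type_synonym 'v mvpoly = "('v \<Rightarrow>\<^sub>0 nat) \<Rightarrow>\<^sub>0 complex"

definition mv_eval :: "'v mvpoly \<Rightarrow> ('v \<Rightarrow> complex) \<Rightarrow> complex" where
  "mv_eval p x = (\<Sum>m\<in>Poly_Mapping.keys p. Poly_Mapping.lookup p m *
     (\<Prod>v\<in>Poly_Mapping.keys m. x v ^ Poly_Mapping.lookup m v))"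

definition mv_homogeneous :: "nat \<Rightarrow> 'v mvpoly \<Rightarrow> bool" where
  "mv_homogeneous k p \<longleftrightarrow>
     (\<forall>m\<in>Poly_Mapping.keys p. (\<Sum>v\<in>Poly_Mapping.keys m. Poly_Mapping.lookup m v) = k)"

definition mv_vars :: "'v mvpoly \<Rightarrow> 'v set" where
  "mv_vars p = (\<Union>m\<in>Poly_Mapping.keys p. Poly_Mapping.keys m)"

(* Hol d is embedded in the projective space CP^(2d+1) of pairs of polynomials of degree at
   most d; the homogeneous coordinate (i, j) is the coefficient of z^j in F_i.  A subvariety
   is the zero locus in Hol d of finitely many homogeneous polynomials in these 2d+2
   coordinates (irreducibility is not required). *)
definition algebraic_subvariety :: "nat \<Rightarrow> (complex option \<Rightarrow> (complex ^ 2) set) set \<Rightarrow> bool" where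
  "algebraic_subvariety d A \<longleftrightarrow>
     (\<exists>P :: (2 \<times> nat) mvpoly set.
        finite P \<and>
        (\<forall>p\<in>P. mv_vars p \<subseteq> UNIV \<times> {..d} \<and> (\<exists>k. mv_homogeneous k p)) \<and>
        A = {proj_map F | F. F \<in> poly_tuples d \<and>
               (\<forall>p\<in>P. mv_eval p (\<lambda>(i, j). coeff (F $ i) j) = 0)})"

end

theory Submission
  imports Defs "HOL-Computational_Algebra.Field_as_Ring" "Jordan_Normal_Form.Determinant"
begin

text \<open>
  For fixed \<open>(F\<^sub>0, F\<^sub>2)\<close> the horizontality equation is linear in \<open>(F\<^sub>1, F\<^sub>3)\<close>, and it always has the
  three-parameter family of solutions \<open>(a F\<^sub>0 + b F\<^sub>2, b F\<^sub>0 + c F\<^sub>2)\<close>, none of which gives a full map.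
  Any further solution does give a full map, and scaling it by \<open>t \<rightarrow> 0\<close> exhibits
  \<open>[F\<^sub>0, F\<^sub>2]\<close> as a collapse point.  Conversely, a full horizontal map near \<open>[F\<^sub>0, 0, F\<^sub>2, 0]\<close> makes
  the rank of the linear system drop at a nearby pair of polynomials; the rank condition is the
  vanishing of finitely many determinants, hence a closed algebraic condition, so it passes to the
  limit.  Four polynomials of degree at most 2 are linearly dependent, so there are no full maps
  for \<open>d \<le> 2\<close>.  For \<open>d \<ge> 3\<close>, \<open>[1 + z^d, z]\<close> is a collapse point, and \<open>[1, z^d]\<close> is not one.
\<close>

no_notation vec_index (infixl "$" 100)
no_notation fps_nth (infixl "$" 75)
hide_const (open) module.smult


section \<open>The linear horizontality equation\<close>

text \<open>Write W for \<open>wronskian\<close>. Horizontality reads W(F_1, F_0) + W(F_3, F_2) = 0.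
  Its known solutions are the symmetric 2x2 matrices applied to (F_0, F_2): the cross terms cancel
  because W is skew. The equation has 2d - 1 coefficients and 2d + 2 unknowns, so a kernel of
  dimension 3 is the least possible. Fullness comes from the fact that W(f, g) = 0 forces
  proportionality: a linear relation among the four components makes the solution a known one. The
  converse meets an obstacle: determinants live on coefficients, but the closure is taken among
  maps, whose tuples are defined only up to a scalar. Instead of choosing coefficients continuously,
  the approximating maps are compared with the given one at finitely many points, their tuples are
  normalised, and a convergent subsequence is extracted. The limit tuple might have lost degree or
  coprimality, but it is parallel to (F_0, 0, F_2, 0), and since F_0, F_2 are coprime of maximum
  degree d it must be a nonzero multiple of it.\<close>

definition wronskian :: "complex poly \<Rightarrow> complex poly \<Rightarrow> complex poly" where
  "wronskian f g = f * pderiv g - g * pderiv f"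

text \<open>The Euler operator z d/dz is diagonal on coefficients, which avoids the index shift of
  \<open>pderiv\<close>.\<close>

lemma coeff_pCons_pderiv: "coeff (pCons 0 (pderiv g)) k = of_nat k * coeff g k"
  by (cases k) (simp_all add: coeff_pderiv)

text \<open>After multiplication by z both derivatives become Euler operators, so the product of the
  coefficients s and r + 1 - s gets the weight (r + 1 - s) - s.\<close>

lemma coeff_wronskian:
  "coeff (wronskian f g) r =
     (\<Sum>s\<le>Suc r. (of_nat (Suc r) - 2 * of_nat s) * coeff f s * coeff g (Suc r - s))"
proof -
  have "coeff (wronskian f g) r = coeff (pCons 0 (wronskian f g)) (Suc r)"
    by simp
  also have "pCons 0 (wronskian f g) = f * pCons 0 (pderiv g) - pCons 0 (pderiv f) * g"
    by (simp add: wronskian_def algebra_simps) 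
  also have "coeff \<dots> (Suc r) =
      (\<Sum>s\<le>Suc r. coeff f s * (of_nat (Suc r - s) * coeff g (Suc r - s))
        - of_nat s * coeff f s * coeff g (Suc r - s))"
    unfolding coeff_diff coeff_mult coeff_pCons_pderiv sum_subtractf[symmetric] ..
  also have "\<dots> = (\<Sum>s\<le>Suc r. (of_nat (Suc r) - 2 * of_nat s) * coeff f s * coeff g (Suc r - s))"
    by (intro sum.cong refl) (simp add: of_nat_diff algebra_simps del: of_nat_Suc)
  finally show ?thesis .
qed

text \<open>The fixed summation range and the coefficients of \<open>f\<close> on the right give the
  shape of a matrix row applied to an unknown vector, as in \<open>collapse_matrix\<close>.\<close>

lemma coeff_wronskian_bounded:
  assumes "degree f \<le> d" "degree g \<le> d"
  shows "coeff (wronskian f g) r =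
    (\<Sum>s\<le>d. (if s \<le> Suc r \<and> Suc r - s \<le> d
       then (of_nat (Suc r) - 2 * of_nat s) * coeff g (Suc r - s) else 0) * coeff f s)"
proof -
  have f: "coeff f s = 0" if "s > d" for s
    using that assms(1) by (simp add: coeff_eq_0)
  have g: "coeff g s = 0" if "s > d" for s
    using that assms(2) by (simp add: coeff_eq_0)
  show ?thesis
    unfolding coeff_wronskian
  proof (rule sum.mono_neutral_cong)
    fix s assume "s \<in> {..Suc r} \<inter> {..d}"
    then show "(of_nat (Suc r) - 2 * of_nat s) * coeff f s * coeff g (Suc r - s) =
      (if s \<le> Suc r \<and> Suc r - s \<le> d
       then (of_nat (Suc r) - 2 * of_nat s) * coeff g (Suc r - s) else 0) * coeff f s"
      using g[of "Suc r - s"] by (cases "Suc r - s \<le> d") (simp_all del: of_nat_Suc)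
  qed (use f in auto)
qed

text \<open>The bound is one better than the naive one: at r = 2d - 1 only s = d survives, and its
  weight 2d - 2s is zero. Hence 2d - 1 equations suffice.\<close>

lemma coeff_wronskian_eq_0:
  assumes "degree f \<le> d" "degree g \<le> d" "Suc r \<ge> 2 * d"
  shows "coeff (wronskian f g) r = 0"
proof -
  have "(of_nat (Suc r) - 2 * of_nat s) * coeff f s * coeff g (Suc r - s) = 0" if "s \<le> Suc r" for s
  proof -
    consider "s > d" | "Suc r - s > d" | "s = d" "Suc r = 2 * d"
      using assms(3) that by linarith
    then show ?thesis
    proof cases
      case 3
      then show ?thesis by (simp del: of_nat_Suc)
    qed (use assms in \<open>simp_all add: coeff_eq_0\<close>)
  qed
  then show ?thesis unfolding coeff_wronskian by (intro sum.neutral) auto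
qed

lemma wronskian_self [simp]: "wronskian f f = 0"
  by (simp add: wronskian_def)

lemma wronskian_swap: "wronskian g f = - wronskian f g"
  by (simp add: wronskian_def)

lemma wronskian_add_left: "wronskian (f + g) h = wronskian f h + wronskian g h"
  by (simp add: wronskian_def pderiv_add algebra_simps)

lemma wronskian_smult_left: "wronskian (smult a f) h = smult a (wronskian f h)"
  by (simp add: wronskian_def pderiv_smult smult_diff_right)

lemma wronskian_add_right: "wronskian h (f + g) = wronskian h f + wronskian h g"
  by (simp add: wronskian_def pderiv_add algebra_simps)

lemma wronskian_smult_right: "wronskian h (smult a f) = smult a (wronskian h f)"
  by (simp add: wronskian_def pderiv_smult smult_diff_right)

definition independent_pair :: "complex poly ^ 2 \<Rightarrow> bool" where
  "independent_pair F \<longleftrightarrow> (\<forall>a b. smult a (F $ 0) + smult b (F $ 1) = 0 \<longrightarrow> a = 0 \<and> b = 0)"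

text \<open>The shared \<open>b\<close> is the off-diagonal entry of the symmetric matrix; it is
  what lets the two cross Wronskians cancel.\<close>

definition trivial_solution :: "complex poly ^ 2 \<Rightarrow> complex poly \<Rightarrow> complex poly \<Rightarrow> bool" where
  "trivial_solution F H K \<longleftrightarrow>
     (\<exists>a b c. H = smult a (F $ 0) + smult b (F $ 1) \<and> K = smult b (F $ 0) + smult c (F $ 1))"

definition extra_solution :: "nat \<Rightarrow> complex poly ^ 2 \<Rightarrow> bool" where
  "extra_solution d F \<longleftrightarrow> (\<exists>H K. degree H \<le> d \<and> degree K \<le> d \<and>
     wronskian H (F $ 0) + wronskian K (F $ 1) = 0 \<and> \<not> trivial_solution F H K)"

section \<open>Three linear equations in four unknowns\<close>

lemma exists_kernel_vector:
  fixes M :: "complex ^ 'n ^ 'n"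
  assumes "M $ k = 0"
  obtains v where "v \<noteq> 0" "M *v v = 0"
proof -
  have "Finite_Cartesian_Product.row k M = 0"
    using assms by (simp add: Finite_Cartesian_Product.row_def Finite_Cartesian_Product.vec_eq_iff)
  then have "Determinants.det M = 0"
    by (rule Determinants.det_zero_row(2))
  then have "\<not> invertible M" by (simp add: invertible_det_nz)
  then show ?thesis
    using that matrix_left_invertible_ker[of M] 
    by (auto simp: invertible_def matrix_left_right_inverse)
qed

lemma UNIV_2_set: "(UNIV :: 2 set) = {0, 1}"
proof -
  have "(2::2) = 0" by simp
  then have "x = 0 \<or> x = 1" for x :: 2 by (metis exhaust_2)
  then show ?thesis by blast
qed

lemma UNIV_4_set: "(UNIV :: 4 set) = {0, 1, 2, 3}"
proof -
  have "(4::4) = 0" by simp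
  then have "x = 0 \<or> x = 1 \<or> x = 2 \<or> x = 3" for x :: 4 by (metis exhaust_4)
  then show ?thesis by blast
qed

lemma sum_UNIV_4: "sum f (UNIV :: 4 set) = f 0 + f 1 + f 2 + (f 3 :: 'a :: comm_monoid_add)"
  unfolding UNIV_4_set by (simp add: add.assoc)

lemma three_equations_four_unknowns:
  fixes p q r :: "4 \<Rightarrow> complex"
  obtains v where "v \<noteq> 0" "(\<Sum>i\<in>UNIV. v $ i * p i) = 0" "(\<Sum>i\<in>UNIV. v $ i * q i) = 0"
    "(\<Sum>i\<in>UNIV. v $ i * r i) = 0"
proof -
  \<comment> \<open>The fourth row is zero, which makes the system square and singular.\<close>
  define M :: "complex ^ 4 ^ 4" where
    "M = (\<chi> k i. if k = 0 then p i else if k = 1 then q i else if k = 2 then r i else 0)"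
  have "M $ 3 = 0" by (simp add: M_def Finite_Cartesian_Product.vec_eq_iff)
  then obtain v where v: "v \<noteq> 0" "M *v v = 0" by (rule exists_kernel_vector)
  have *: "(\<Sum>i\<in>UNIV. M $ k $ i * v $ i) = 0" for k
    using v(2) by (simp add: Finite_Cartesian_Product.vec_eq_iff matrix_vector_mult_def)
  show ?thesis
    using *[of 0] *[of 1] *[of 2] by (intro that[OF v(1)]) (simp_all add: M_def mult.commute)
qed


section \<open>Determinantal characterisation of extra solutions\<close>

text \<open>
  The first \<open>2 d - 1\<close> rows are the coefficients of the horizontality equation in terms of those of
  the unknowns \<open>(H, K)\<close>.  The last three rows select the coefficients \<open>H\<^sub>i, H\<^sub>j, K\<^sub>j\<close>; for suitable
  \<open>i, j\<close> these three coordinates are injective on the trivial solutions, so that the square matrix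
  is singular for all \<open>i, j\<close> exactly when there is an extra solution.
\<close>
definition collapse_matrix :: "nat \<Rightarrow> nat \<Rightarrow> nat \<Rightarrow> (2 \<times> nat \<Rightarrow> complex) \<Rightarrow> complex mat" where
  "collapse_matrix d i j x = Matrix.mat (2 * d + 2) (2 * d + 2) (\<lambda>(r, c).
     if r < 2 * d - 1 then
       (let a = (if c \<le> d then 0 else 1); s = (if c \<le> d then c else c - Suc d)
        in if s \<le> Suc r \<and> Suc r - s \<le> d
           then (of_nat (Suc r) - 2 * of_nat s) * x (a, Suc r - s) else 0)
     else if r = 2 * d - 1 \<and> c = i \<or> r = 2 * d \<and> c = j \<or> r = 2 * d + 1 \<and> c = Suc d + j
     then 1 else 0)"

abbreviation coefficients :: "complex poly ^ 2 \<Rightarrow> 2 \<times> nat \<Rightarrow> complex" where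
  "coefficients F \<equiv> (\<lambda>(i, j). coeff (F $ i) j)"

lemma sum_split_halves:
  "(\<Sum>c\<in>{0..<2 * d + 2}. f c) = (\<Sum>s\<le>d. f s) + (\<Sum>s\<le>d. f (Suc d + s) :: 'a :: comm_monoid_add)"
proof -
  have "(\<Sum>c\<in>{0..<2 * d + 2}. f c) = (\<Sum>c\<in>{0..<Suc d}. f c) + (\<Sum>c\<in>{Suc d..<2 * d + 2}. f c)"
    by (rule sum.atLeastLessThan_concat[symmetric]) auto
  also have "(\<Sum>c\<in>{Suc d..<2 * d + 2}. f c) = (\<Sum>s\<in>{0..<Suc d}. f (Suc d + s))"
    using sum.shift_bounds_nat_ivl[of f 0 "Suc d" "Suc d"]
    by (simp add: add.commute mult_2)
  finally show ?thesis by (simp add: atLeast0LessThan lessThan_Suc_atMost)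
qed

text \<open>The vector stacks the d + 1 coefficients of \<open>H\<close> on those of
  \<open>K\<close>, hence the offset \<open>Suc d\<close>.\<close>

lemma collapse_matrix_mult:
  assumes d: "d \<ge> 1" and ij: "i \<le> d" "j \<le> d" and F: "\<And>k. degree (F $ k) \<le> d"
    and HK: "degree H \<le> d" "degree K \<le> d"
    and v: "v \<in> carrier_vec (2 * d + 2)"
    and vH: "\<And>s. s \<le> d \<Longrightarrow> vec_index v s = coeff H s"
    and vK: "\<And>s. s \<le> d \<Longrightarrow> vec_index v (Suc d + s) = coeff K s"
  shows "collapse_matrix d i j (coefficients F) *\<^sub>v v = 0\<^sub>v (2 * d + 2) \<longleftrightarrow>
    wronskian H (F $ 0) + wronskian K (F $ 1) = 0 \<and> coeff H i = 0 \<and> coeff H j = 0 \<and> coeff K j = 0"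
    (is "?l \<longleftrightarrow> ?w = 0 \<and> _")
proof -
  define M where "M = collapse_matrix d i j (coefficients F)"
  have comp: "vec_index (M *\<^sub>v v) r =
      (\<Sum>s\<le>d. M $$ (r, s) * coeff H s) + (\<Sum>s\<le>d. M $$ (r, Suc d + s) * coeff K s)"
    if "r < 2 * d + 2" for r
  proof -
    have "vec_index (M *\<^sub>v v) r = (\<Sum>c\<in>{0..<2 * d + 2}. M $$ (r, c) * vec_index v c)"
      using that v by (simp add: M_def collapse_matrix_def scalar_prod_def)
    also have "\<dots> = (\<Sum>s\<le>d. M $$ (r, s) * coeff H s) + (\<Sum>s\<le>d. M $$ (r, Suc d + s) * coeff K s)"
      unfolding sum_split_halves using vH vK by simp
    finally show ?thesis .
  qed
  have low: "vec_index (M *\<^sub>v v) r = coeff ?w r" if r: "r < 2 * d - 1" for r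
  proof -
    have r': "r < 2 * d + 2" using r by simp
    show ?thesis
      unfolding comp[OF r'] coeff_add coeff_wronskian_bounded[OF HK(1) F]
        coeff_wronskian_bounded[OF HK(2) F]
      using r by (intro arg_cong2[where f = "(+)"] sum.cong) (simp_all add: M_def collapse_matrix_def)
  qed
  have high: "vec_index (M *\<^sub>v v) (2 * d - 1) = coeff H i"
    "vec_index (M *\<^sub>v v) (2 * d) = coeff H j" "vec_index (M *\<^sub>v v) (2 * d + 1) = coeff K j"
  proof -
    have b: "2 * d - 1 < 2 * d + 2" "2 * d < 2 * d + 2" "2 * d + 1 < 2 * d + 2" by auto
    have delta: "(\<Sum>s\<le>d. (if s = k then 1 else 0) * f s) = f k" if "k \<le> d" 
      for k and f :: "nat \<Rightarrow> complex"
    proof -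
      have "(\<Sum>s\<le>d. (if s = k then 1 else 0) * f s) = (\<Sum>s\<le>d. if s = k then f s else 0)"
        by (intro sum.cong) auto
      then show ?thesis using that by simp
    qed
    show "vec_index (M *\<^sub>v v) (2 * d - 1) = coeff H i"
    proof -
      have "(\<Sum>s\<le>d. M $$ (2 * d - 1, s) * coeff H s) = (\<Sum>s\<le>d. (if s = i then 1 else 0) * coeff H s)"
        using d by (intro sum.cong) (auto simp: M_def collapse_matrix_def)
      moreover have "(\<Sum>s\<le>d. M $$ (2 * d - 1, Suc d + s) * coeff K s) = 0"
        using d ij by (intro sum.neutral) (auto simp: M_def collapse_matrix_def)
      ultimately show ?thesis unfolding comp[OF b(1)] by (simp add: delta[OF ij(1)])
    qed
    show "vec_index (M *\<^sub>v v) (2 * d) = coeff H j"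
    proof -
      have "(\<Sum>s\<le>d. M $$ (2 * d, s) * coeff H s) = (\<Sum>s\<le>d. (if s = j then 1 else 0) * coeff H s)"
        using d by (intro sum.cong) (auto simp: M_def collapse_matrix_def)
      moreover have "(\<Sum>s\<le>d. M $$ (2 * d, Suc d + s) * coeff K s) = 0"
        using d ij by (intro sum.neutral) (auto simp: M_def collapse_matrix_def)
      ultimately show ?thesis unfolding comp[OF b(2)] by (simp add: delta[OF ij(2)])
    qed
    show "vec_index (M *\<^sub>v v) (2 * d + 1) = coeff K j"
    proof -
      have "(\<Sum>s\<le>d. M $$ (2 * d + 1, Suc d + s) * coeff K s) = (\<Sum>s\<le>d. (if s = j then 1 else 0) * coeff K s)"
        using d by (intro sum.cong) (auto simp: M_def collapse_matrix_def)
      moreover have "(\<Sum>s\<le>d. M $$ (2 * d + 1, s) * coeff H s) = 0"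
        using d ij by (intro sum.neutral) (auto simp: M_def collapse_matrix_def)
      ultimately show ?thesis unfolding comp[OF b(3)] by (simp add: delta[OF ij(2)])
    qed
  qed
  \<comment> \<open>The coefficients without a row vanish anyway, so the first 2d - 1 rows express
    the whole polynomial equation.\<close>
  have wr0: "coeff ?w r = 0" if "r \<ge> 2 * d - 1" for r
    using that F HK by (simp add: coeff_wronskian_eq_0[where d = d])
  have "?l \<longleftrightarrow> (\<forall>r < 2 * d + 2. vec_index (M *\<^sub>v v) r = 0)"
    using v by (auto simp: M_def[symmetric] intro!: eq_vecI) (simp_all add: M_def collapse_matrix_def)
  also have "\<dots> \<longleftrightarrow> (\<forall>r < 2 * d - 1. vec_index (M *\<^sub>v v) r = 0) \<and> vec_index (M *\<^sub>v v) (2 * d - 1) = 0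
      \<and> vec_index (M *\<^sub>v v) (2 * d) = 0 \<and> vec_index (M *\<^sub>v v) (2 * d + 1) = 0"
  proof -
    have "r < 2 * d + 2 \<longleftrightarrow> r < 2 * d - 1 \<or> r = 2 * d - 1 \<or> r = 2 * d \<or> r = 2 * d + 1" for r
      using d by linarith
    then show ?thesis by metis
  qed
  also have "(\<forall>r < 2 * d - 1. vec_index (M *\<^sub>v v) r = 0) \<longleftrightarrow> ?w = 0"
    using low wr0 by (metis coeff_0 poly_eqI not_le)
  finally show ?thesis by (simp only: high)
qed

text \<open>For a trivial solution with parameters a, b, c, the coordinates H_i and H_j determine a
  and b through the minor; then K_j determines c because the coefficient j of \<open>F $ 1\<close>
  is nonzero.\<close>

lemma exists_nonzero_minor:
  assumes F: "independent_pair F" "\<And>k. degree (F $ k) \<le> d"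
  obtains i j where "i \<le> d" "j \<le> d" "coeff (F $ 1) j \<noteq> 0"
    "coeff (F $ 0) i * coeff (F $ 1) j \<noteq> coeff (F $ 0) j * coeff (F $ 1) i"
proof -
  have "F $ 1 \<noteq> 0"
  proof
    assume "F $ 1 = 0"
    then have "smult 0 (F $ 0) + smult 1 (F $ 1) = 0" by simp
    then show False using F(1) unfolding independent_pair_def by (metis zero_neq_one)
  qed
  then obtain j where j: "coeff (F $ 1) j \<noteq> 0" by (metis coeff_0 poly_eqI)
  have jd: "j \<le> d" using F(2)[of 1] j le_degree le_trans by blast
  have "smult (coeff (F $ 1) j) (F $ 0) + smult (- coeff (F $ 0) j) (F $ 1) \<noteq> 0"
    using F(1) j unfolding independent_pair_def by blast
  then obtain i where "coeff (smult (coeff (F $ 1) j) (F $ 0) + smult (- coeff (F $ 0) j) (F $ 1)) i \<noteq> 0"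
    by (metis coeff_0 poly_eqI)
  then have i: "coeff (F $ 0) i * coeff (F $ 1) j \<noteq> coeff (F $ 0) j * coeff (F $ 1) i"
    by (simp add: mult.commute)
  then have "coeff (F $ 0) i \<noteq> 0 \<or> coeff (F $ 1) i \<noteq> 0" by auto
  then have "i \<le> d" using F(2) le_degree le_trans by blast
  then show ?thesis using that jd i j by blast
qed

text \<open>Three trivial solutions and the extra one span a four-dimensional space, on which the
  three selected coordinates must have a common nontrivial zero, whatever i and j are.\<close>

lemma det_collapse_matrix_eq_0:
  assumes d: "d \<ge> 1" and F: "independent_pair F" "\<And>k. degree (F $ k) \<le> d"
    and ex: "extra_solution d F" and ij: "i \<le> d" "j \<le> d"
  shows "Determinant.det (collapse_matrix d i j (coefficients F)) = 0"
proof -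
  obtain H K where HK: "degree H \<le> d" "degree K \<le> d"
      "wronskian H (F $ 0) + wronskian K (F $ 1) = 0" "\<not> trivial_solution F H K"
    using ex unfolding extra_solution_def by blast
  \<comment> \<open>The \<open>H\<close>- and \<open>K\<close>-components of the four solutions
    (F_0, 0), (F_1, F_0), (0, F_1) and (H, K), for the pair with components F_0, F_1.\<close>
  define h k where "h = (\<lambda>m::4. if m = 0 then F $ 0 else if m = 1 then F $ 1 else if m = 2 then 0 else H)"
    and "k = (\<lambda>m::4. if m = 0 then 0 else if m = 1 then F $ 0 else if m = 2 then F $ 1 else K)"
  obtain a where a: "a \<noteq> 0" "(\<Sum>m\<in>UNIV. a $ m * coeff (h m) i) = 0"
      "(\<Sum>m\<in>UNIV. a $ m * coeff (h m) j) = 0" "(\<Sum>m\<in>UNIV. a $ m * coeff (k m) j) = 0"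
    by (rule three_equations_four_unknowns)
  define H' K' where "H' = smult (a $ 0) (F $ 0) + smult (a $ 1) (F $ 1) + smult (a $ 3) H"
    and "K' = smult (a $ 1) (F $ 0) + smult (a $ 2) (F $ 1) + smult (a $ 3) K"
  have deg: "degree H' \<le> d" "degree K' \<le> d"
    unfolding H'_def K'_def using F(2) HK by (auto intro!: degree_add_le order_trans[OF degree_smult_le])
  have coeffs: "coeff H' i = 0" "coeff H' j = 0" "coeff K' j = 0"
    using a(2-) by (simp_all add: H'_def K'_def h_def k_def sum_UNIV_4)
  have w: "wronskian H' (F $ 0) + wronskian K' (F $ 1) = 0"
  proof -
    have "wronskian H' (F $ 0) + wronskian K' (F $ 1)
        = smult (a $ 3) (wronskian H (F $ 0) + wronskian K (F $ 1))"
      unfolding H'_def K'_def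
      by (simp add: wronskian_add_left wronskian_smult_left wronskian_swap[of "F $ 0"] smult_add_right)
    then show ?thesis using HK(3) by simp
  qed
  have nz: "H' \<noteq> 0 \<or> K' \<noteq> 0"
  proof (rule ccontr)
    assume "\<not> ?thesis"
    then have z: "H' = 0" "K' = 0" by auto
    show False
    proof (cases "a $ 3 = 0")
      case True
      then have "a $ 0 = 0 \<and> a $ 1 = 0" "a $ 1 = 0 \<and> a $ 2 = 0"
        using z F(1) unfolding H'_def K'_def independent_pair_def by auto
      then have "a $ m = 0" for m using True UNIV_4_set by (metis UNIV_I empty_iff insert_iff)
      then show False using a(1) by (simp add: Finite_Cartesian_Product.vec_eq_iff)
    next
      \<comment> \<open>Solving for the last of the four solutions would exhibit it as a trivial
        one.\<close>
      case False
      have "H = smult (- a $ 0 / a $ 3) (F $ 0) + smult (- a $ 1 / a $ 3) (F $ 1)"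
        using arg_cong[OF z(1), of "smult (1 / a $ 3)"] False unfolding H'_def
        by (simp add: smult_add_right eq_neg_iff_add_eq_0 algebra_simps)
      moreover have "K = smult (- a $ 1 / a $ 3) (F $ 0) + smult (- a $ 2 / a $ 3) (F $ 1)"
        using arg_cong[OF z(2), of "smult (1 / a $ 3)"] False unfolding K'_def
        by (simp add: smult_add_right eq_neg_iff_add_eq_0 algebra_simps)
      ultimately show False using HK(4) unfolding trivial_solution_def by blast
    qed
  qed
  define v where "v = Matrix.vec (2 * d + 2) (\<lambda>c. if c \<le> d then coeff H' c else coeff K' (c - Suc d))"
  have v: "v \<in> carrier_vec (2 * d + 2)" "\<And>s. s \<le> d \<Longrightarrow> vec_index v s = coeff H' s"
      "\<And>s. s \<le> d \<Longrightarrow> vec_index v (Suc d + s) = coeff K' s"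
    by (auto simp: v_def)
  have "v \<noteq> 0\<^sub>v (2 * d + 2)"
  proof
    assume v0: "v = 0\<^sub>v (2 * d + 2)"
    have "coeff H' s = 0 \<and> coeff K' s = 0" for s
    proof (cases "s \<le> d")
      case True
      then show ?thesis using v(2,3)[of s] unfolding v0 by simp
    qed (use deg in \<open>simp add: coeff_eq_0\<close>)
    then show False using nz by (simp add: poly_eq_iff)
  qed
  moreover have "collapse_matrix d i j (coefficients F) *\<^sub>v v = 0\<^sub>v (2 * d + 2)"
    using collapse_matrix_mult[OF d ij F(2) deg v] w coeffs by simp
  moreover have "collapse_matrix d i j (coefficients F) \<in> carrier_mat (2 * d + 2) (2 * d + 2)"
    by (simp add: collapse_matrix_def)
  ultimately show ?thesis using det_0_iff_vec_prod_zero v(1) by blast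
qed

lemma extra_solution_of_det_eq_0:
  assumes d: "d \<ge> 1" and F: "independent_pair F" "\<And>k. degree (F $ k) \<le> d"
    and det: "\<And>i j. i \<le> d \<Longrightarrow> j \<le> d \<Longrightarrow> Determinant.det (collapse_matrix d i j (coefficients F)) = 0"
  shows "extra_solution d F"
proof -
  obtain i j where ij: "i \<le> d" "j \<le> d" "coeff (F $ 1) j \<noteq> 0"
    "coeff (F $ 0) i * coeff (F $ 1) j \<noteq> coeff (F $ 0) j * coeff (F $ 1) i"
    using F by (rule exists_nonzero_minor)
  have "collapse_matrix d i j (coefficients F) \<in> carrier_mat (2 * d + 2) (2 * d + 2)"
    by (simp add: collapse_matrix_def)
  then obtain v where v: "v \<in> carrier_vec (2 * d + 2)" "v \<noteq> 0\<^sub>v (2 * d + 2)"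
      "collapse_matrix d i j (coefficients F) *\<^sub>v v = 0\<^sub>v (2 * d + 2)"
    using det[OF ij(1,2)] det_0_iff_vec_prod_zero by blast
  define H K where "H = (\<Sum>s\<le>d. monom (vec_index v s) s)"
    and "K = (\<Sum>s\<le>d. monom (vec_index v (Suc d + s)) s)"
  have deg: "degree H \<le> d" "degree K \<le> d"
    unfolding H_def K_def by (auto intro!: degree_sum_le order_trans[OF degree_monom_le])
  have vHK: "vec_index v s = coeff H s" "vec_index v (Suc d + s) = coeff K s" if "s \<le> d" for s
    using that by (simp_all add: H_def K_def coeff_sum coeff_monom)
  have sol: "wronskian H (F $ 0) + wronskian K (F $ 1) = 0" "coeff H i = 0" "coeff H j = 0" "coeff K j = 0"
    using v(3) collapse_matrix_mult[OF d ij(1,2) F(2) deg v(1)] vHK by auto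
  have "\<not> trivial_solution F H K"
  proof
    assume "trivial_solution F H K"
    then obtain a b c where abc: "H = smult a (F $ 0) + smult b (F $ 1)" 
        "K = smult b (F $ 0) + smult c (F $ 1)"
      unfolding trivial_solution_def by blast
    let ?D = "coeff (F $ 0) i * coeff (F $ 1) j - coeff (F $ 0) j * coeff (F $ 1) i"
    have e: "a * coeff (F $ 0) i + b * coeff (F $ 1) i = 0" "a * coeff (F $ 0) j + b * coeff (F $ 1) j = 0"
      using sol(2,3) by (simp_all add: abc)
    \<comment> \<open>Cramer's rule: the minor annihilates \<open>a\<close> and
      \<open>b\<close>.\<close>
    have "a * ?D = (a * coeff (F $ 0) i + b * coeff (F $ 1) i) * coeff (F $ 1) j
        - (a * coeff (F $ 0) j + b * coeff (F $ 1) j) * coeff (F $ 1) i"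
      by (simp add: algebra_simps)
    moreover have "b * ?D = (a * coeff (F $ 0) j + b * coeff (F $ 1) j) * coeff (F $ 0) i
        - (a * coeff (F $ 0) i + b * coeff (F $ 1) i) * coeff (F $ 0) j"
      by (simp add: algebra_simps)
    ultimately have "a * ?D = 0" "b * ?D = 0" unfolding e by simp_all
    then have "a = 0" "b = 0" using ij(4) by auto
    moreover have "c = 0" using sol(4) ij(3) by (simp add: abc \<open>b = 0\<close>)
    ultimately have "H = 0" "K = 0" by (simp_all add: abc)
    have "vec_index v r = 0" if "r < 2 * d + 2" for r
    proof (cases "r \<le> d")
      case True
      then show ?thesis using vHK(1) \<open>H = 0\<close> by simp
    next
      case False
      then show ?thesis using vHK(2)[of "r - Suc d"] \<open>K = 0\<close> that by simp
    qed
    then have "v = 0\<^sub>v (2 * d + 2)" using v(1) by (intro eq_vecI) auto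
    with v(2) show False by simp
  qed
  then show ?thesis unfolding extra_solution_def using deg sol(1) by blast
qed


section \<open>Determinants as homogeneous polynomials\<close>

definition monomial_value :: "('v \<Rightarrow>\<^sub>0 nat) \<Rightarrow> ('v \<Rightarrow> complex) \<Rightarrow> complex" where
  "monomial_value m x = (\<Prod>v\<in>Poly_Mapping.keys m. x v ^ Poly_Mapping.lookup m v)"

definition monomial_degree :: "('v \<Rightarrow>\<^sub>0 nat) \<Rightarrow> nat" where
  "monomial_degree m = (\<Sum>v\<in>Poly_Mapping.keys m. Poly_Mapping.lookup m v)"

lemma monomial_degree_add: "monomial_degree (a + b) = monomial_degree a + monomial_degree b"
  unfolding monomial_degree_def by (rule setsum_keys_plus_distrib) auto

lemma monomial_value_superset:
  assumes "finite S" "Poly_Mapping.keys m \<subseteq> S"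
  shows "monomial_value m x = (\<Prod>v\<in>S. x v ^ Poly_Mapping.lookup m v)"
  unfolding monomial_value_def
  using assms by (intro prod.mono_neutral_left) (auto simp: in_keys_iff)

lemma monomial_value_add: "monomial_value (a + b) x = monomial_value a x * monomial_value b x"
proof -
  let ?S = "Poly_Mapping.keys a \<union> Poly_Mapping.keys b"
  have "Poly_Mapping.keys (a + b) \<subseteq> ?S" by (rule keys_add)
  then show ?thesis
    by (simp add: monomial_value_superset[where S = ?S] lookup_add power_add prod.distrib)
qed

lemma mv_eval_eq: "mv_eval p x = (\<Sum>m\<in>Poly_Mapping.keys p. Poly_Mapping.lookup p m * monomial_value m x)"
  by (simp add: mv_eval_def monomial_value_def)

lemma mv_eval_add: "mv_eval (p + q) x = mv_eval p x + mv_eval q x"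
  unfolding mv_eval_eq by (rule setsum_keys_plus_distrib) (auto simp: distrib_right)

lemma mv_homogeneous_iff:
  "mv_homogeneous k p \<longleftrightarrow> (\<forall>m\<in>Poly_Mapping.keys p. monomial_degree m = k)"
  by (simp add: mv_homogeneous_def monomial_degree_def)

text \<open>Forms are handled through the functions they define, so the Leibniz formula can be used
  directly without multiplying polynomials.\<close>

definition form_on :: "'v set \<Rightarrow> nat \<Rightarrow> (('v \<Rightarrow> complex) \<Rightarrow> complex) \<Rightarrow> bool" where
  "form_on V k \<phi> \<longleftrightarrow> (\<exists>p. mv_homogeneous k p \<and> mv_vars p \<subseteq> V \<and> (\<forall>x. mv_eval p x = \<phi> x))"

text \<open>Each matrix entry is a multiple of one variable or a constant, so every Leibniz term is
  a single monomial: products are needed for monomials only, sums for forms only. The coefficient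
  may be 0.\<close>

definition monomial_on :: "'v set \<Rightarrow> nat \<Rightarrow> (('v \<Rightarrow> complex) \<Rightarrow> complex) \<Rightarrow> bool" where
  "monomial_on V k \<phi> \<longleftrightarrow> (\<exists>m c. Poly_Mapping.keys m \<subseteq> V \<and> monomial_degree m = k \<and>
     (\<forall>x. \<phi> x = c * monomial_value m x))"

lemma monomial_on_const: "monomial_on V 0 (\<lambda>x. c)"
  unfolding monomial_on_def
  by (rule exI[of _ 0]) (auto simp: monomial_degree_def monomial_value_def)

lemma monomial_on_var: "v \<in> V \<Longrightarrow> monomial_on V 1 (\<lambda>x. c * x v)"
  unfolding monomial_on_def
  by (rule exI[of _ "Poly_Mapping.single v 1"]) (auto simp: monomial_degree_def monomial_value_def)

text \<open>A zero entry in a linear row must also count as degree 1, so that the degree depends on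
  the row alone.\<close>

lemma monomial_on_zero: "v \<in> V \<Longrightarrow> monomial_on V 1 (\<lambda>x. 0)"
  using monomial_on_var[of v V 0] by simp

lemma monomial_on_mult:
  assumes "monomial_on V k \<phi>" "monomial_on V l \<psi>"
  shows "monomial_on V (k + l) (\<lambda>x. \<phi> x * \<psi> x)"
proof -
  obtain m c n e where "Poly_Mapping.keys m \<subseteq> V" "monomial_degree m = k" "\<And>x. \<phi> x = c * monomial_value m x"
    "Poly_Mapping.keys n \<subseteq> V" "monomial_degree n = l" "\<And>x. \<psi> x = e * monomial_value n x"
    using assms unfolding monomial_on_def by auto
  then show ?thesis
    unfolding monomial_on_def using keys_add[of m n]
    by (intro exI[of _ "m + n"] exI[of _ "c * e"]) (auto simp: monomial_degree_add monomial_value_add)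
qed

lemma monomial_on_prod:
  assumes "finite I" "\<And>i. i \<in> I \<Longrightarrow> monomial_on V (k i) (\<phi> i)"
  shows "monomial_on V (\<Sum>i\<in>I. k i) (\<lambda>x. \<Prod>i\<in>I. \<phi> i x)"
  using assms
proof (induction I rule: finite_induct)
  case empty
  then show ?case by (simp add: monomial_on_const)
next
  case (insert i I)
  then have "monomial_on V (k i + (\<Sum>i\<in>I. k i)) (\<lambda>x. \<phi> i x * (\<Prod>i\<in>I. \<phi> i x))"
    by (intro monomial_on_mult) auto
  with insert show ?case by simp
qed

lemma form_on_monomial:
  assumes "monomial_on V k \<phi>"
  shows "form_on V k \<phi>"
proof -
  obtain m c where m: "Poly_Mapping.keys m \<subseteq> V" "monomial_degree m = k" "\<And>x. \<phi> x = c * monomial_value m x"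
    using assms unfolding monomial_on_def by auto
  then show ?thesis
    unfolding form_on_def
    by (intro exI[of _ "Poly_Mapping.single m c"])
       (auto simp: mv_homogeneous_iff mv_vars_def mv_eval_eq split: if_splits)
qed

lemma form_on_add:
  assumes "form_on V k \<phi>" "form_on V k \<psi>"
  shows "form_on V k (\<lambda>x. \<phi> x + \<psi> x)"
proof -
  obtain p q where pq: "mv_homogeneous k p" "mv_vars p \<subseteq> V" "\<And>x. mv_eval p x = \<phi> x"
    "mv_homogeneous k q" "mv_vars q \<subseteq> V" "\<And>x. mv_eval q x = \<psi> x"
    using assms unfolding form_on_def by auto
  have "mv_homogeneous k (p + q)" "mv_vars (p + q) \<subseteq> V"
    using pq keys_add[of p q] unfolding mv_homogeneous_iff mv_vars_def by blast+
  then show ?thesis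
    unfolding form_on_def using pq by (intro exI[of _ "p + q"]) (auto simp: mv_eval_add)
qed

lemma form_on_sum:
  assumes "finite I" "\<And>i. i \<in> I \<Longrightarrow> form_on V k (\<phi> i)"
  shows "form_on V k (\<lambda>x. \<Sum>i\<in>I. \<phi> i x)"
  using assms
proof (induction I rule: finite_induct)
  case empty
  have "form_on V k (\<lambda>x. 0)" unfolding form_on_def
    by (rule exI[of _ 0]) (simp add: mv_homogeneous_def mv_vars_def mv_eval_def)
  then show ?case by simp
next
  case (insert i I)
  then have "form_on V k (\<lambda>x. \<phi> i x + (\<Sum>i\<in>I. \<phi> i x))"
    by (intro form_on_add) auto
  with insert show ?case by simp
qed

text \<open>Every permutation picks one entry from each row, so all Leibniz terms share the sum of
  the row degrees.\<close>

lemma form_on_det: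
  assumes M: "\<And>x. M x \<in> carrier_mat n n"
    and entries: "\<And>i j. i < n \<Longrightarrow> j < n \<Longrightarrow> monomial_on V (k i) (\<lambda>x. M x $$ (i, j))"
  shows "form_on V (\<Sum>i\<in>{0..<n}. k i) (\<lambda>x. Determinant.det (M x))"
proof -
  have "form_on V (\<Sum>i\<in>{0..<n}. k i)
     (\<lambda>x. \<Sum>p | p permutes {0..<n}. of_int (sign p) * (\<Prod>i = 0..<n. M x $$ (i, p i)))"
  proof (intro form_on_sum form_on_monomial)
    show "finite {p. p permutes {0..<n}}" by (simp add: finite_permutations)
    fix p assume "p \<in> {p. p permutes {0..<n}}"
    then have p: "p permutes {0..<n}" by simp
    have "p i < n" if "i < n" for i using permutes_in_image[OF p, of i] that by simp
    then have "monomial_on V (0 + (\<Sum>i\<in>{0..<n}. k i))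
        (\<lambda>x. of_int (sign p) * (\<Prod>i = 0..<n. M x $$ (i, p i)))"
      by (intro monomial_on_mult monomial_on_const monomial_on_prod entries) auto
    then show "monomial_on V (\<Sum>i\<in>{0..<n}. k i)
        (\<lambda>x. of_int (sign p) * (\<Prod>i = 0..<n. M x $$ (i, p i)))" by simp
  qed
  moreover have "dim_row (M x) = n" "dim_col (M x) = n" for x
    using M[of x] by auto
  ultimately show ?thesis by (simp add: Determinant.det_def)
qed

text \<open>The coefficient rows are linear in the variables and the three selecting rows are
  constant.\<close>

lemma form_on_det_collapse_matrix:
  "\<exists>k. form_on (UNIV \<times> {..d}) k (\<lambda>x. Determinant.det (collapse_matrix d i j x))"
proof
  show "form_on (UNIV \<times> {..d}) (\<Sum>r\<in>{0..<2 * d + 2}. if r < 2 * d - 1 then 1 else 0)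
    (\<lambda>x. Determinant.det (collapse_matrix d i j x))"
  proof (rule form_on_det)
    show "collapse_matrix d i j x \<in> carrier_mat (2 * d + 2) (2 * d + 2)" for x
      by (simp add: collapse_matrix_def)
    fix r c assume rc: "r < 2 * d + 2" "c < 2 * d + 2"
    show "monomial_on (UNIV \<times> {..d}) (if r < 2 * d - 1 then 1 else 0) (\<lambda>x. collapse_matrix d i j x $$ (r, c))"
    proof (cases "r < 2 * d - 1")
      case True
      define a s where "a = (if c \<le> d then 0 else 1 :: 2)" and "s = (if c \<le> d then c else c - Suc d)"
      have e: "collapse_matrix d i j x $$ (r, c) = (if s \<le> Suc r \<and> Suc r - s \<le> d
           then (of_nat (Suc r) - 2 * of_nat s) * x (a, Suc r - s) else 0)" for x
        using True rc by (simp add: collapse_matrix_def Let_def a_def s_def)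
      show ?thesis
      proof (cases "s \<le> Suc r \<and> Suc r - s \<le> d")
        case t: True
        show ?thesis unfolding e if_P[OF t] if_P[OF True] by (rule monomial_on_var) (use t in simp)
      next
        case f: False
        show ?thesis unfolding e if_not_P[OF f] if_P[OF True] 
          by (rule monomial_on_zero[of "(0, 0)"]) simp
      qed
    next
      case False
      then show ?thesis using rc by (simp add: collapse_matrix_def monomial_on_const)
    qed
  qed
qed

lemma extra_solution_algebraic:
  assumes d: "d \<ge> 1"
  obtains P where "finite P" "\<And>p. p \<in> P \<Longrightarrow> mv_vars p \<subseteq> UNIV \<times> {..d} \<and> (\<exists>k. mv_homogeneous k p)"
    "\<And>F. independent_pair F \<Longrightarrow> (\<And>k. degree (F $ k) \<le> d) \<Longrightarrow>
       extra_solution d F \<longleftrightarrow> (\<forall>p\<in>P. mv_eval p (coefficients F) = 0)"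
proof -
  have "\<exists>p. (mv_vars p \<subseteq> UNIV \<times> {..d} \<and> (\<exists>k. mv_homogeneous k p)) \<and>
      (\<forall>x. mv_eval p x = Determinant.det (collapse_matrix d i j x))" for i j
    using form_on_det_collapse_matrix[of d i j] unfolding form_on_def by blast
  then obtain p where p: "mv_vars (p i j) \<subseteq> UNIV \<times> {..d}" "\<exists>k. mv_homogeneous k (p i j)"
      "mv_eval (p i j) x = Determinant.det (collapse_matrix d i j x)" for i j x
    by metis
  \<comment> \<open>All index pairs are taken, because the suitable pair from
    \<open>exists_nonzero_minor\<close> varies with \<open>F\<close>.\<close>
  let ?P = "(\<lambda>(i, j). p i j) ` ({..d} \<times> {..d})"
  show ?thesis
  proof (rule that[of ?P])
    fix F :: "complex poly ^ 2" assume F: "independent_pair F" "\<And>k. degree (F $ k) \<le> d"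
    show "extra_solution d F \<longleftrightarrow> (\<forall>p\<in>?P. mv_eval p (coefficients F) = 0)"
      using det_collapse_matrix_eq_0[OF d F] extra_solution_of_det_eq_0[OF d F]
      by (auto simp: p(3))
  qed (use p in auto)
qed


section \<open>Topology of projective space and of the mapping space\<close>

lemma span_singleton_scale:
  fixes v :: "complex ^ 'n"
  assumes "c \<noteq> 0"
  shows "vec.span {c *s v} = vec.span {v}"
proof -
  have "k *s v = (k / c) *s (c *s v)" for k using assms by (simp add: vector_smult_assoc)
  then have "range (\<lambda>k. k *s v) \<subseteq> range (\<lambda>k. k *s (c *s v))" by (metis image_subsetI rangeI)
  moreover have "range (\<lambda>k. k *s (c *s v)) \<subseteq> range (\<lambda>k. k *s v)"
    unfolding vector_smult_assoc by blast
  ultimately show ?thesis unfolding vec.span_singleton by simp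
qed

lemma span_singleton_eqD:
  fixes v :: "complex ^ 'n"
  assumes "vec.span {v} = vec.span {u}" "v \<noteq> 0"
  obtains c where "c \<noteq> 0" "v = c *s u"
proof -
  have "v \<in> vec.span {u}" using assms(1) vec.span_base[of v "{v}"] by simp
  then obtain c where "v = c *s u" unfolding vec.span_singleton by auto
  moreover from this assms(2) have "c \<noteq> 0" by auto
  ultimately show ?thesis using that by blast
qed

lemma span_singleton_in_cp_points:
  fixes v :: "complex ^ 'n"
  shows "v \<noteq> 0 \<Longrightarrow> vec.span {v} \<in> cp_points"
  by (simp add: cp_points_def vec.dim_span)

text \<open>Intended for scale-invariant \<open>Q\<close>, where it turns an open cone condition on
  vectors into an open set of lines.\<close>

definition lines_with :: "(complex ^ 'n \<Rightarrow> bool) \<Rightarrow> (complex ^ 'n) set set" where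
  "lines_with Q = {vec.span {v} | v. v \<noteq> 0 \<and> Q v}"

lemma span_in_lines_with_iff:
  fixes v :: "complex ^ 'n"
  assumes "\<And>c v. c \<noteq> 0 \<Longrightarrow> Q (c *s v) \<longleftrightarrow> Q v" "v \<noteq> 0"
  shows "vec.span {v} \<in> lines_with Q \<longleftrightarrow> Q v"
proof
  assume "vec.span {v} \<in> lines_with Q"
  then obtain u where u: "vec.span {v} = vec.span {u}" "Q u" unfolding lines_with_def by blast
  then show "Q v" using span_singleton_eqD[OF u(1) assms(2)] assms(1) by metis
qed (use assms(2) in \<open>auto simp: lines_with_def\<close>)

lemma openin_lines_with:
  fixes Q :: "complex ^ 'n \<Rightarrow> bool"
  assumes Q: "\<And>c v. c \<noteq> 0 \<Longrightarrow> Q (c *s v) \<longleftrightarrow> Q v" and op: "open {v. v \<noteq> 0 \<and> Q v}"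
  shows "openin cp_top (lines_with Q)"
proof -
  have "{v. v \<noteq> 0 \<and> vec.span {v} \<in> lines_with Q} = {v. v \<noteq> 0 \<and> Q v}"
    using span_in_lines_with_iff[of Q, OF Q] by blast
  then show ?thesis using op span_singleton_in_cp_points unfolding openin_cp_top
    by (auto simp: lines_with_def)
qed

section \<open>Homogeneous coordinates at finite points and at infinity\<close>

lemma max_degree_eq_iff:
  "max_degree F = d \<longleftrightarrow> (\<forall>i. degree (F $ i) \<le> d) \<and> (\<exists>i. degree (F $ i) = d)"
  unfolding max_degree_def by (subst Max_eq_iff) auto

lemma poly_tuples_degree_le: "F \<in> poly_tuples d \<Longrightarrow> degree (F $ i) \<le> d"
  unfolding poly_tuples_def using max_degree_eq_iff by blast

lemma poly_tuples_value_nonzero: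
  assumes "F \<in> poly_tuples d"
  shows "(\<chi> i. poly (F $ i) z) \<noteq> 0"
proof
  assume "(\<chi> i. poly (F $ i) z) = 0"
  then have "[:- z, 1:] dvd F $ i" for i
    by (simp add: Finite_Cartesian_Product.vec_eq_iff poly_eq_0_iff_dvd)
  then have "is_unit [:- z, 1:]" using assms unfolding poly_tuples_def coprime_tuple_def by blast
  then show False by (simp add: is_unit_iff_degree)
qed

lemma poly_tuples_leading_nonzero:
  assumes "F \<in> poly_tuples d"
  shows "(\<chi> i. coeff (F $ i) d) \<noteq> 0"
proof
  assume "(\<chi> i. coeff (F $ i) d) = 0"
  then have c: "coeff (F $ i) d = 0" for i by (simp add: Finite_Cartesian_Product.vec_eq_iff)
  have deg: "degree (F $ i) \<le> d" for i by (rule poly_tuples_degree_le[OF assms])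
  obtain i where i: "degree (F $ i) = d" using assms unfolding poly_tuples_def using max_degree_eq_iff by blast
  \<comment> \<open>A vanishing leading coefficient leaves only the zero polynomial, so d = 0; then
    all components vanish and 0 would be a common divisor.\<close>
  then have "F $ i = 0" using c[of i] by auto
  then have "d = 0" using i by simp
  have "F $ k = 0" for k
    using deg[of k] c[of k] \<open>d = 0\<close> by (metis le_zero_eq leading_coeff_0_iff)
  then have "\<forall>k. 0 dvd F $ k" by simp
  then have "is_unit (0 :: complex poly)" using assms unfolding poly_tuples_def coprime_tuple_def by blast
  then show False by simp
qed

lemma proj_map_Some: "proj_map F (Some z) = vec.span {\<chi> i. poly (F $ i) z}"
  by (simp add: proj_map_def)

lemma proj_map_None: "F \<in> poly_tuples d \<Longrightarrow> proj_map F None = vec.span {\<chi> i. coeff (F $ i) d}"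
  by (simp add: proj_map_def poly_tuples_def)

lemma poly_eq_sum_le:
  fixes p :: "'a :: comm_semiring_1 poly"
  shows "degree p \<le> d \<Longrightarrow> poly p z = (\<Sum>k\<le>d. coeff p k * z ^ k)"
  by (subst poly_altdef[of p z], rule sum.mono_neutral_left) (auto simp: coeff_eq_0)

section \<open>Continuity of polynomial families in the compact-open topology\<close>

lemma topspace_sphere2 [simp]: "topspace sphere2 = UNIV"
  by (auto simp: sphere2_def UNIV_option_conv)

lemma topspace_cp_top: "topspace cp_top = cp_points"
proof -
  have eq: "{v :: complex ^ 'n. v \<noteq> 0 \<and> vec.span {v} \<in> cp_points} = - {0}"
    using span_singleton_in_cp_points by auto
  have "open (- {0 :: complex ^ 'n})" by (rule open_Compl) simp
  then have "openin cp_top (cp_points :: (complex ^ 'n) set set)"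
    unfolding openin_cp_top eq by simp
  then show ?thesis by (metis openin_cp_top openin_subset openin_topspace subset_antisym)
qed

text \<open>Continuity is joint in the parameter and the point, and is checked in two charts:
  \<open>ev\<close> on the plane and \<open>ev'\<close> in the coordinate 1/z near infinity.\<close>

lemma continuous_map_proj_map_family:
  fixes G :: "complex \<Rightarrow> complex poly ^ 'n"
  assumes G: "\<And>t. G t \<in> poly_tuples d"
    and cont: "\<And>i k. continuous_on UNIV (\<lambda>t. coeff (G t $ i) k)"
  shows "continuous_map (prod_topology euclidean sphere2) cp_top (\<lambda>(t, p). proj_map (G t) p)"
proof -
  define ev where "ev = (\<lambda>x. (\<chi> i. \<Sum>k\<le>d. coeff (G (fst x) $ i) k * snd x ^ k) :: complex ^ 'n)"
  \<comment> \<open>The reversed polynomials: their value at 0 is the vector of degree-d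
    coefficients.\<close>
  define ev' where "ev' = (\<lambda>x. (\<chi> i. \<Sum>k\<le>d. coeff (G (fst x) $ i) k * snd x ^ (d - k)) :: complex ^ 'n)"
  have cf: "continuous_on UNIV (\<lambda>x :: complex \<times> complex. coeff (G (fst x) $ i) k)" for i k
    by (rule continuous_on_compose2[OF cont]) (auto intro: continuous_intros)
  have cev: "continuous_on UNIV ev" and cev': "continuous_on UNIV ev'"
    unfolding ev_def ev'_def by (intro continuous_on_vec_lambda continuous_intros cf)+
  have ev: "proj_map (G t) (Some z) = vec.span {ev (t, z)}" "ev (t, z) \<noteq> 0" for t z
  proof -
    have "(\<chi> i. poly (G t $ i) z) = ev (t, z)"
      unfolding ev_def fst_conv snd_conv
      using poly_eq_sum_le[OF poly_tuples_degree_le[OF G]] by simp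
    then show "proj_map (G t) (Some z) = vec.span {ev (t, z)}" "ev (t, z) \<noteq> 0"
      using poly_tuples_value_nonzero[OF G, of t z] by (simp_all add: proj_map_Some)
  qed
  have ev0: "ev' (t, 0) = (\<chi> i. coeff (G t $ i) d)" for t
  proof -
    have "(\<Sum>k\<le>d. coeff (G t $ i) k * 0 ^ (d - k)) = (\<Sum>k\<le>d. if k = d then coeff (G t $ i) k else 0)" for i
      by (intro sum.cong) auto
    then show ?thesis by (simp add: ev'_def Finite_Cartesian_Product.vec_eq_iff)
  qed
  have evN: "proj_map (G t) None = vec.span {ev' (t, 0)}" "ev' (t, 0) \<noteq> 0" for t
    using proj_map_None[OF G] poly_tuples_leading_nonzero[OF G, of t] by (simp_all add: ev0)
  have scale: "ev (t, z) = z ^ d *s ev' (t, inverse z)" if "z \<noteq> 0" for t z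
  proof -
    have "(\<Sum>k\<le>d. f k * z ^ k) = z ^ d * (\<Sum>k\<le>d. f k * inverse z ^ (d - k))" for f :: "nat \<Rightarrow> complex"
      unfolding sum_distrib_left
    proof (rule sum.cong)
      fix k assume "k \<in> {..d}"
      then have "z ^ d = z ^ k * z ^ (d - k)" by (simp flip: power_add)
      then show "f k * z ^ k = z ^ d * (f k * inverse z ^ (d - k))"
        using that by (simp add: power_inverse)
    qed simp
    then show ?thesis
      by (simp add: ev_def ev'_def Finite_Cartesian_Product.vec_eq_iff)
  qed
  have "openin (prod_topology euclidean sphere2) {x. proj_map (G (fst x)) (snd x) \<in> U}" (is "openin _ ?S")
    if U: "openin cp_top U" for U
    unfolding openin_prod_topology_alt
  proof (intro allI impI)
    fix t p assume tp: "(t, p) \<in> ?S"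
    define W where "W = {v. v \<noteq> 0 \<and> vec.span {v} \<in> U}"
    have W: "open W" using U unfolding openin_cp_top W_def by blast
    show "\<exists>A B. openin euclidean A \<and> openin sphere2 B \<and> t \<in> A \<and> p \<in> B \<and> A \<times> B \<subseteq> ?S"
    proof (cases p)
      case (Some z)
      have "open (ev -` W)" using cev W by (simp add: continuous_on_open_vimage)
      moreover have "(t, z) \<in> ev -` W" using tp Some ev by (simp add: W_def)
      ultimately obtain A B where AB: "open A" "open B" "(t, z) \<in> A \<times> B" "A \<times> B \<subseteq> ev -` W"
        by (rule open_prod_elim)
      have "A \<times> Some ` B \<subseteq> ?S"
        using AB(4) ev by (fastforce simp: W_def)
      moreover have "openin sphere2 (Some ` B)"
        using AB(2) by (simp add: sphere2_def openin_Alexandroff_compactification_image_Some)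
      ultimately show ?thesis using AB Some by (intro exI[of _ A] exI[of _ "Some ` B"]) auto
    next
      case None
      have "open (ev' -` W)" using cev' W by (simp add: continuous_on_open_vimage)
      moreover have "(t, 0) \<in> ev' -` W" using tp None evN by (simp add: W_def)
      ultimately obtain A B where AB: "open A" "open B" "(t, 0) \<in> A \<times> B" "A \<times> B \<subseteq> ev' -` W"
        by (rule open_prod_elim)
      obtain r where r: "r > 0" "ball 0 r \<subseteq> B" using AB by (auto elim: openE)
      \<comment> \<open>Outside the closed disc of radius 1/r the coordinate 1/z lies in the ball of
        radius r.\<close>
      define V where "V = insert None (Some ` (UNIV - cball (0::complex) (inverse r)))"
      have "openin sphere2 V"
        unfolding sphere2_def V_def openin_Alexandroff_compactification
        by (rule disjI2, rule exI[of _ "cball (0::complex) (inverse r)"]) auto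
      moreover have "A \<times> V \<subseteq> ?S"
      proof
        fix x assume "x \<in> A \<times> V"
        then obtain s q where x: "x = (s, q)" "s \<in> A" "q \<in> V" by blast
        show "x \<in> ?S"
        proof (cases q)
          case None
          have "(s, 0) \<in> A \<times> B" using x AB(3) by auto
          then show ?thesis using AB(4) evN x None by (auto simp: W_def)
        next
          case (Some z)
          then have z: "norm z > inverse r" using x(3) by (auto simp: V_def)
          then have "z \<noteq> 0" using r(1) by auto
          have "norm (inverse z) < r" using z r(1)
            by (metis inverse_inverse_eq inverse_less_imp_less norm_inverse positive_imp_inverse_positive less_imp_inverse_less)
          then have "(s, inverse z) \<in> A \<times> B" using r(2) x(2) by auto
          then have "vec.span {ev' (s, inverse z)} \<in> U" using AB(4) by (auto simp: W_def)
          then have "vec.span {ev (s, z)} \<in> U"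
            unfolding scale[OF \<open>z \<noteq> 0\<close>] using span_singleton_scale \<open>z \<noteq> 0\<close> by (metis power_not_zero)
          then show ?thesis using x Some ev by simp
        qed
      qed
      ultimately show ?thesis using AB None by (intro exI[of _ A] exI[of _ V]) (auto simp: V_def)
    qed
  qed
  moreover have "proj_map (G t) p \<in> cp_points" for t p
    by (cases p) (simp_all only: ev evN span_singleton_in_cp_points not_False_eq_True)
  ultimately show ?thesis
    unfolding continuous_map_def topspace_cp_top by (auto simp: case_prod_unfold)
qed

text \<open>This half of the exponential law holds for all spaces: the tube lemma thickens {t} x K
  inside the open preimage of \<open>U\<close>.\<close>

lemma continuous_map_curry_compact_open:
  assumes \<phi>: "continuous_map (prod_topology T X) Y (\<lambda>(t, p). \<phi> t p)"
  shows "continuous_map T (compact_open X Y) \<phi>"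
  unfolding compact_open_def
proof (rule continuous_on_generated_topo)
  have cont: "continuous_map X Y (\<phi> t)" if "t \<in> topspace T" for t
  proof -
    have "continuous_map X (prod_topology T X) (\<lambda>p. (t, p))"
      using that by (intro continuous_map_pairedI) auto
    from continuous_map_compose[OF this \<phi>] show ?thesis by (simp add: o_def)
  qed
  \<comment> \<open>The empty compact set makes the set of all continuous maps subbasic.\<close>
  then show "\<phi> ` topspace T \<subseteq> \<Union> {{f. continuous_map X Y f \<and> f ` K \<subseteq> U} |K U. compactin X K \<and> openin Y U}"
    by (auto intro!: exI[of _ "{}"] exI[of _ "{f. continuous_map X Y f}"])
  fix S assume "S \<in> {{f. continuous_map X Y f \<and> f ` K \<subseteq> U} |K U. compactin X K \<and> openin Y U}"
  then obtain K U where S: "S = {f. continuous_map X Y f \<and> f ` K \<subseteq> U}" and K: "compactin X K"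
    and U: "openin Y U" by blast
  let ?W = "{x \<in> topspace (prod_topology T X). (\<lambda>(t, p). \<phi> t p) x \<in> U}"
  have W: "openin (prod_topology T X) ?W" using \<phi> U by (rule openin_continuous_map_preimage)
  have KX: "K \<subseteq> topspace X" using K by (rule compactin_subset_topspace)
  show "openin T (\<phi> -` S \<inter> topspace T)"
  proof (subst openin_subopen, intro ballI)
    fix t assume t: "t \<in> \<phi> -` S \<inter> topspace T"
    then have "{t} \<times> K \<subseteq> ?W" using KX by (auto simp: S)
    then obtain A B where AB: "openin T A" "t \<in> A" "K \<subseteq> B" "A \<times> B \<subseteq> ?W"
      using tube_lemma_right[OF W K, of t] t by blast
    have "A \<subseteq> \<phi> -` S \<inter> topspace T"
    proof
      fix s assume s: "s \<in> A"
      then have sT: "s \<in> topspace T" using openin_subset[OF AB(1)] by blast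
      have "\<phi> s p \<in> U" if "p \<in> K" for p
      proof -
        have "(s, p) \<in> ?W" using AB(3,4) s that by blast
        then show ?thesis by simp
      qed
      then show "s \<in> \<phi> -` S \<inter> topspace T" using sT cont[OF sT] by (auto simp: S)
    qed
    then show "\<exists>A. openin T A \<and> t \<in> A \<and> A \<subseteq> \<phi> -` S \<inter> topspace T" using AB by blast
  qed
qed

lemma proj_map_in_compact_open:
  assumes "F \<in> poly_tuples d"
  shows "continuous_map sphere2 cp_top (proj_map F)"
    and "proj_map F \<in> topspace (compact_open sphere2 cp_top)"
proof -
  have c: "continuous_map (prod_topology euclidean sphere2) cp_top (\<lambda>(t::complex, p). proj_map F p)"
    using assms by (intro continuous_map_proj_map_family[of "\<lambda>_. F", of d]) auto
  have "continuous_map euclidean (compact_open sphere2 cp_top) (\<lambda>t::complex. proj_map F)"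
    using continuous_map_curry_compact_open[of euclidean sphere2 cp_top "\<lambda>_. proj_map F"] c by simp
  then show "proj_map F \<in> topspace (compact_open sphere2 cp_top)"
    by (auto simp: continuous_map_def)
  have "continuous_map sphere2 (prod_topology euclidean sphere2) (\<lambda>p. (0::complex, p))"
    by (intro continuous_map_pairedI) auto
  from continuous_map_compose[OF this c] show "continuous_map sphere2 cp_top (proj_map F)"
    by (simp add: o_def)
qed


section \<open>Full maps\<close>

definition combination :: "complex ^ 'n \<Rightarrow> complex poly ^ 'n \<Rightarrow> complex poly" where
  "combination a F = (\<Sum>i\<in>UNIV. smult (a $ i) (F $ i))"

lemma coeff_combination: "coeff (combination a F) k = (\<Sum>i\<in>UNIV. a $ i * coeff (F $ i) k)"
  by (simp add: combination_def coeff_sum)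

lemma poly_combination: "poly (combination a F) z = (\<Sum>i\<in>UNIV. a $ i * poly (F $ i) z)"
  by (simp add: combination_def poly_sum)

lemma subspace_hyperplane: "vec.subspace {w :: complex ^ 'n. (\<Sum>i\<in>UNIV. a $ i * w $ i) = 0}"
  unfolding vec.subspace_def
  by (auto simp: distrib_left sum.distrib mult.left_commute[of _ c for c] simp flip: sum_distrib_left)

lemma dim_hyperplane:
  fixes a :: "complex ^ 'n"
  assumes "a \<noteq> 0"
  shows "Suc (vec.dim {w :: complex ^ 'n. (\<Sum>i\<in>UNIV. a $ i * w $ i) = 0}) = CARD('n)"
proof -
  let ?H = "{w :: complex ^ 'n. (\<Sum>i\<in>UNIV. a $ i * w $ i) = 0}"
  obtain k where k: "a $ k \<noteq> 0" using assms by (auto simp: Finite_Cartesian_Product.vec_eq_iff)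
  let ?e = "axis k 1 :: complex ^ 'n"
  have ak: "(\<Sum>i\<in>UNIV. a $ i * ?e $ i) = a $ k"
    by (simp add: axis_def if_distrib[of "(*) _"] cong: if_cong)
  have span: "vec.span ?H = ?H" using subspace_hyperplane by (rule vec.span_eq_iff[THEN iffD2])
  have "?e \<notin> vec.span ?H" unfolding span using ak k by simp
  then have "vec.dim (insert ?e ?H) = Suc (vec.dim ?H)" by (simp add: vec.dim_insert)
  moreover have "vec.span (insert ?e ?H) = UNIV"
  proof -
    have "w \<in> vec.span (insert ?e ?H)" for w
    proof -
      let ?c = "(\<Sum>i\<in>UNIV. a $ i * w $ i) / a $ k"
      have "(\<Sum>i\<in>UNIV. a $ i * (w - ?c *s ?e) $ i) = (\<Sum>i\<in>UNIV. a $ i * w $ i) - ?c * (\<Sum>i\<in>UNIV. a $ i * ?e $ i)"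
        by (simp add: right_diff_distrib sum_subtractf sum_distrib_left mult.left_commute)
      then have "w - ?c *s ?e \<in> ?H" unfolding ak using k by simp
      then show ?thesis unfolding vec.span_breakdown_eq span by blast
    qed
    then show ?thesis by blast
  qed
  then have "vec.dim (insert ?e ?H) = CARD('n)" by (metis vec.dim_span vec_dim_card)
  ultimately show ?thesis by simp
qed

lemma dim_3_subspace_in_hyperplane:
  fixes W :: "(complex ^ 4) set"
  assumes "vec.dim W = 3"
  obtains a where "a \<noteq> 0" "\<And>w. w \<in> W \<Longrightarrow> (\<Sum>i\<in>UNIV. a $ i * w $ i) = 0"
proof -
  obtain B where B: "W \<subseteq> vec.span B" "card B = 3"
    using vec.basis_exists[of W] assms by metis
  obtain x y z where xyz: "B = {x, y, z}" using B(2) by (auto simp: card_3_iff)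
  obtain a where a: "a \<noteq> 0" "(\<Sum>i\<in>UNIV. a $ i * x $ i) = 0" "(\<Sum>i\<in>UNIV. a $ i * y $ i) = 0"
      "(\<Sum>i\<in>UNIV. a $ i * z $ i) = 0"
    by (rule three_equations_four_unknowns)
  have "vec.span B \<subseteq> {w. (\<Sum>i\<in>UNIV. a $ i * w $ i) = 0}"
    using a by (intro vec.span_minimal subspace_hyperplane) (auto simp: xyz)
  then show ?thesis using that[OF a(1)] B(1) by blast
qed

text \<open>A three-dimensional subspace lies in the kernel of a nonzero linear form, and the form
  vanishes along the map exactly when the corresponding combination of components is zero.\<close>

lemma full_proj_map_iff:
  assumes F: "F \<in> poly_tuples d"
  shows "full (proj_map F) \<longleftrightarrow> (\<forall>a. combination a F = 0 \<longrightarrow> a = 0)"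
proof
  assume full: "full (proj_map F)"
  show "\<forall>a. combination a F = 0 \<longrightarrow> a = 0"
  proof (intro allI impI, rule ccontr)
    fix a assume a: "combination a F = 0" "a \<noteq> 0"
    let ?H = "{w :: complex ^ 4. (\<Sum>i\<in>UNIV. a $ i * w $ i) = 0}"
    have "vec.dim ?H = 3" using dim_hyperplane[OF a(2)] by simp
    moreover have "proj_map F p \<subseteq> ?H" for p
    proof (cases p)
      case None
      show ?thesis unfolding None proj_map_None[OF F]
        using coeff_combination[of a F d] a(1) by (intro vec.span_minimal subspace_hyperplane) auto
    next
      case (Some z)
      show ?thesis unfolding Some proj_map_Some
        using poly_combination[of a F z] a(1) by (intro vec.span_minimal subspace_hyperplane) auto
    qed
    ultimately show False using full subspace_hyperplane unfolding full_def by blast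
  qed
next
  assume ind: "\<forall>a. combination a F = 0 \<longrightarrow> a = 0"
  show "full (proj_map F)"
    unfolding full_def
  proof clarify
    fix W :: "(complex ^ 4) set" assume W: "vec.dim W = 3" "\<forall>p. proj_map F p \<subseteq> W"
    obtain a where a: "a \<noteq> 0" "\<And>w. w \<in> W \<Longrightarrow> (\<Sum>i\<in>UNIV. a $ i * w $ i) = 0"
      using W(1) by (rule dim_3_subspace_in_hyperplane) blast
    have "poly (combination a F) z = 0" for z
    proof -
      have "(\<chi> i. poly (F $ i) z) \<in> proj_map F (Some z)"
        unfolding proj_map_Some by (rule vec.span_base) simp
      then have "(\<chi> i. poly (F $ i) z) \<in> W" using W(2) by blast
      from a(2)[OF this] show ?thesis by (simp add: poly_combination)
    qed
    then have "combination a F = 0" using poly_all_0_iff_0[of "combination a F"] by blast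
    then show False using ind a(1) by blast
  qed
qed

lemma no_full_of_degree_le_2:
  assumes F: "F \<in> poly_tuples d" and d: "d \<le> 2"
  shows "\<not> full (proj_map F)"
proof -
  obtain a :: "complex ^ 4" where a: "a \<noteq> 0" "(\<Sum>i\<in>UNIV. a $ i * coeff (F $ i) 0) = 0"
     "(\<Sum>i\<in>UNIV. a $ i * coeff (F $ i) 1) = 0" "(\<Sum>i\<in>UNIV. a $ i * coeff (F $ i) 2) = 0"
    by (rule three_equations_four_unknowns)
  have "coeff (combination a F) k = 0" for k
  proof -
    consider "k = 0" | "k = 1" | "k = 2" | "k > 2" by linarith
    then show ?thesis
    proof cases
      case 4
      then have "coeff (F $ i) k = 0" for i
        using poly_tuples_degree_le[OF F, of i] d by (intro coeff_eq_0) linarith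
      then show ?thesis by (simp add: coeff_combination)
    qed (use a in \<open>simp_all add: coeff_combination\<close>)
  qed
  then have "combination a F = 0" by (intro poly_eqI) simp
  then show ?thesis using full_proj_map_iff[OF F] a(1) by blast
qed

section \<open>Completing a pair to a map into projective 3-space\<close>

definition quadruple :: "complex poly ^ 2 \<Rightarrow> complex poly \<Rightarrow> complex poly \<Rightarrow> complex poly ^ 4" where
  "quadruple F H K = (\<chi> i. if i = 0 then F $ 0 else if i = 1 then H else if i = 2 then F $ 1 else K)"

lemma quadruple_nth [simp]:
  "quadruple F H K $ 0 = F $ 0" "quadruple F H K $ 1 = H"
  "quadruple F H K $ 2 = F $ 1" "quadruple F H K $ 3 = K"
  by (simp_all add: quadruple_def)

lemma all_2_iff: "(\<forall>i::2. P i) \<longleftrightarrow> P 0 \<and> P 1"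
  by (metis UNIV_2_set UNIV_I empty_iff insert_iff)

lemma all_4_iff: "(\<forall>i::4. P i) \<longleftrightarrow> P 0 \<and> P 1 \<and> P 2 \<and> P 3"
  by (metis UNIV_4_set UNIV_I empty_iff insert_iff)

lemma ex_2_iff: "(\<exists>i::2. P i) \<longleftrightarrow> P 0 \<or> P 1"
  using all_2_iff[of "\<lambda>i. \<not> P i"] by blast

lemma ex_4_iff: "(\<exists>i::4. P i) \<longleftrightarrow> P 0 \<or> P 1 \<or> P 2 \<or> P 3"
  using all_4_iff[of "\<lambda>i. \<not> P i"] by blast

lemma quadruple_in_poly_tuples:
  assumes "F \<in> poly_tuples d" "degree H \<le> d" "degree K \<le> d"
  shows "quadruple F H K \<in> poly_tuples d"
  using assms unfolding poly_tuples_def mem_Collect_eq coprime_tuple_def max_degree_eq_iff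
    all_2_iff all_4_iff ex_2_iff ex_4_iff by auto

lemma cp_embed_proj_map:
  assumes "F \<in> poly_tuples d"
  shows "cp_embed \<circ> proj_map F = proj_map (quadruple F 0 0)"
proof
  define e :: "complex ^ 2 \<Rightarrow> complex ^ 4" where
    "e = (\<lambda>v. \<chi> i. if i = 0 then v $ 0 else if i = 2 then v $ 1 else 0)"
  have emb: "cp_embed (vec.span {v}) = vec.span {e v}" for v
  proof -
    have "e (k *s v) = k *s e v" for k by (simp add: e_def Finite_Cartesian_Product.vec_eq_iff)
    then show ?thesis unfolding cp_embed_def e_def[symmetric] vec.span_singleton image_image by simp
  qed
  have q: "quadruple F 0 0 \<in> poly_tuples d" using assms by (intro quadruple_in_poly_tuples) auto
  fix p show "(cp_embed \<circ> proj_map F) p = proj_map (quadruple F 0 0) p"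
  proof (cases p)
    case None
    have "e (\<chi> i. coeff (F $ i) d) = (\<chi> i. coeff (quadruple F 0 0 $ i) d)"
      by (simp add: e_def Finite_Cartesian_Product.vec_eq_iff all_4_iff)
    then show ?thesis by (simp add: None proj_map_None[OF assms] proj_map_None[OF q] emb)
  next
    case (Some z)
    have "e (\<chi> i. poly (F $ i) z) = (\<chi> i. poly (quadruple F 0 0 $ i) z)"
      by (simp add: e_def Finite_Cartesian_Product.vec_eq_iff all_4_iff)
    then show ?thesis by (simp add: Some proj_map_Some emb)
  qed
qed


section \<open>Extra solutions yield collapse points\<close>

text \<open>For degrees m and n, not both 0, the coefficient of W(f, g) at m + n - 1 is n - m times
  both leading coefficients.\<close>

lemma degree_eq_of_wronskian_eq_0:
  assumes "wronskian f g = 0" "f \<noteq> 0" "g \<noteq> 0"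
  shows "degree f = degree g"
proof (cases "degree f + degree g = 0")
  case False
  let ?m = "degree f" and ?n = "degree g"
  obtain r where r: "?m + ?n = Suc r" using False by (cases "?m + ?n") auto
  have "coeff f s * coeff g (?m + ?n - s) = 0" if "s \<noteq> ?m" for s
    using that by (cases "s < ?m") (auto simp: coeff_eq_0)
  then have "(\<Sum>s\<le>Suc r. (of_nat (Suc r) - 2 * of_nat s) * coeff f s * coeff g (Suc r - s))
    = (\<Sum>s\<le>Suc r. if s = ?m then (of_nat (Suc r) - 2 * of_nat s) * coeff f s * coeff g (Suc r - s) else 0)"
    unfolding r by (intro sum.cong) (auto simp: mult.assoc)
  also have "\<dots> = (of_nat (Suc r) - 2 * of_nat ?m) * coeff f ?m * coeff g (Suc r - ?m)"
    using r by (simp del: of_nat_Suc)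
  also have "\<dots> = (of_nat ?n - of_nat ?m) * (coeff f ?m * coeff g ?n)"
    unfolding r[symmetric] by (simp add: algebra_simps)
  finally have "(of_nat ?n - of_nat ?m) * (coeff f ?m * coeff g ?n) = (0 :: complex)"
    using assms(1) unfolding coeff_wronskian[symmetric] by simp
  then show ?thesis using assms by simp
qed simp

text \<open>Subtracting a multiple of \<open>g\<close> kills the coefficient at the degree of
  \<open>g\<close> but keeps the Wronskian zero; a nonzero remainder would have exactly that
  degree.\<close>

lemma proportional_of_wronskian_eq_0:
  assumes w: "wronskian f g = 0" and g: "g \<noteq> 0"
  obtains c where "f = smult c g"
proof -
  define c where "c = coeff f (degree g) / lead_coeff g"
  define h where "h = f + smult (- c) g"
  have "wronskian h g = 0"
    unfolding h_def using w by (simp only: wronskian_add_left wronskian_smult_left) simp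
  moreover have "coeff h (degree g) = 0" using g by (simp add: h_def c_def)
  ultimately have "h = 0" using degree_eq_of_wronskian_eq_0[of h g] g by (metis leading_coeff_0_iff)
  then have "f = smult c g" by (simp add: h_def)
  then show ?thesis using that by blast
qed

text \<open>The relation eliminates \<open>K\<close> or \<open>H\<close>. Horizontality then
  collapses to a single vanishing Wronskian, and proportionality supplies the remaining
  parameter.\<close>

lemma trivial_solution_of_combination:
  assumes F: "independent_pair F" and w: "wronskian H (F $ 0) + wronskian K (F $ 1) = 0"
    and c: "combination a (quadruple F H K) = 0" and a: "a \<noteq> 0"
  shows "trivial_solution F H K"
proof -
  have c': "smult (a $ 0) (F $ 0) + smult (a $ 1) H + smult (a $ 2) (F $ 1) + smult (a $ 3) K = 0"
    using c by (simp add: combination_def sum_UNIV_4)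
  consider (K) "a $ 3 \<noteq> 0" | (H) "a $ 3 = 0" "a $ 1 \<noteq> 0" | (F) "a $ 3 = 0" "a $ 1 = 0" by blast
  then show ?thesis
  proof cases
    case F
    then have "a $ 0 = 0 \<and> a $ 2 = 0" using c' F assms(1) unfolding independent_pair_def by simp
    then have "a = 0" using F by (simp add: Finite_Cartesian_Product.vec_eq_iff all_4_iff)
    with a show ?thesis by simp
  next
    case H
    define \<beta> \<gamma> where "\<beta> = - a $ 0 / a $ 1" and "\<gamma> = - a $ 2 / a $ 1"
    have H_eq: "H = smult \<beta> (F $ 0) + smult \<gamma> (F $ 1)"
      using arg_cong[OF c', of "smult (1 / a $ 1)"] H unfolding \<beta>_def \<gamma>_def
      by (simp add: smult_add_right eq_neg_iff_add_eq_0 algebra_simps)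
    have "wronskian (K + smult (- \<gamma>) (F $ 0)) (F $ 1) = 0"
      using w unfolding H_eq wronskian_add_left wronskian_smult_left wronskian_swap[of "F $ 0" "F $ 1"]
      by (simp add: algebra_simps)
    moreover have "F $ 1 \<noteq> 0" using assms(1) unfolding independent_pair_def
      by (metis add.right_neutral smult_0_left smult_0_right zero_neq_one)
    ultimately obtain e where "K + smult (- \<gamma>) (F $ 0) = smult e (F $ 1)"
      by (rule proportional_of_wronskian_eq_0)
    then have "K = smult \<gamma> (F $ 0) + smult e (F $ 1)" by (simp add: algebra_simps)
    then show ?thesis using H_eq unfolding trivial_solution_def by blast
  next
    case K
    define \<alpha> \<beta> \<gamma> where "\<alpha> = - a $ 1 / a $ 3" and "\<beta> = - a $ 0 / a $ 3" and "\<gamma> = - a $ 2 / a $ 3"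
    have K_eq: "K = smult \<alpha> H + smult \<beta> (F $ 0) + smult \<gamma> (F $ 1)"
      using arg_cong[OF c', of "smult (1 / a $ 3)"] K unfolding \<alpha>_def \<beta>_def \<gamma>_def
      by (simp add: smult_add_right eq_neg_iff_add_eq_0 algebra_simps)
    \<comment> \<open>Substituting for \<open>K\<close> gives W(H, F_0) + \<alpha> W(H, F_1) +
      \<beta> W(F_0, F_1), which factors as W(H - \<beta> F_1, F_0 + \<alpha> F_1).\<close>
    define G where "G = F $ 0 + smult \<alpha> (F $ 1)"
    have "wronskian (H + smult (- \<beta>) (F $ 1)) G = 0"
      using w unfolding K_eq G_def wronskian_add_left wronskian_smult_left wronskian_add_right
        wronskian_smult_right wronskian_swap[of "F $ 0" "F $ 1"]
      by (simp add: smult_add_right algebra_simps)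
    moreover have "G \<noteq> 0"
      using assms(1) unfolding independent_pair_def G_def by (metis smult_1_left zero_neq_one)
    ultimately obtain e where "H + smult (- \<beta>) (F $ 1) = smult e G"
      by (rule proportional_of_wronskian_eq_0)
    then have "H = smult e G + smult \<beta> (F $ 1)" by (simp add: algebra_simps)
    then have H_eq: "H = smult e (F $ 0) + smult (e * \<alpha> + \<beta>) (F $ 1)"
      by (simp add: G_def smult_add_right smult_add_left)
    have "K = smult (e * \<alpha> + \<beta>) (F $ 0) + smult (\<alpha> * (e * \<alpha> + \<beta>) + \<gamma>) (F $ 1)"
      unfolding K_eq H_eq by (simp add: smult_add_right smult_add_left algebra_simps)
    then show ?thesis using H_eq unfolding trivial_solution_def by blast
  qed
qed

lemma horizontal_quadruple_iff:
  "horizontal_tuple (quadruple F H K) \<longleftrightarrow> wronskian H (F $ 0) + wronskian K (F $ 1) = 0"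
  by (simp add: horizontal_tuple_def wronskian_def algebra_simps)

definition even_part :: "complex poly ^ 4 \<Rightarrow> complex poly ^ 2" where
  "even_part G = (\<chi> i. if i = 0 then G $ 0 else G $ 2)"

lemma even_part_nth [simp]: "even_part G $ 0 = G $ 0" "even_part G $ 1 = G $ 2"
  by (simp_all add: even_part_def)

lemma quadruple_even_part: "quadruple (even_part G) (G $ 1) (G $ 3) = G"
  by (simp add: Finite_Cartesian_Product.vec_eq_iff all_4_iff)

text \<open>The odd components solve the equation of the even ones; were they a trivial solution,
  \<open>G $ 1\<close> would satisfy a linear relation with \<open>G $ 0\<close> and
  \<open>G $ 2\<close>.\<close>

lemma full_horizontal_even_part:
  assumes G: "G \<in> poly_tuples d" "horizontal_tuple G" "full (proj_map G)"
  shows "independent_pair (even_part G)" "extra_solution d (even_part G)"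
proof -
  have ind: "combination a G = 0 \<Longrightarrow> a = 0" for a using G full_proj_map_iff by blast
  have comb: "combination (\<chi> i. if i = 0 then p else if i = 1 then q else if i = 2 then r else s) G
     = smult p (G $ 0) + smult q (G $ 1) + smult r (G $ 2) + smult s (G $ 3)" for p q r s
    by (simp add: combination_def sum_UNIV_4)
  have ind': "p = 0 \<and> q = 0 \<and> r = 0 \<and> s = 0"
    if "smult p (G $ 0) + smult q (G $ 1) + smult r (G $ 2) + smult s (G $ 3) = 0" for p q r s
    using ind[unfolded Finite_Cartesian_Product.vec_eq_iff all_4_iff] that comb[of p q r s] by fastforce
  show "independent_pair (even_part G)"
    unfolding independent_pair_def using ind'[of _ 0 _ 0] by auto
  have "\<not> trivial_solution (even_part G) (G $ 1) (G $ 3)"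
  proof
    assume "trivial_solution (even_part G) (G $ 1) (G $ 3)"
    then obtain a b where "G $ 1 = smult a (G $ 0) + smult b (G $ 2)"
      unfolding trivial_solution_def by auto
    then have "smult a (G $ 0) + smult (-1) (G $ 1) + smult b (G $ 2) + smult 0 (G $ 3) = 0" by simp
    from ind'[OF this] show False by simp
  qed
  then show "extra_solution d (even_part G)"
    using G(2) poly_tuples_degree_le[OF G(1)] horizontal_quadruple_iff[of "even_part G" "G $ 1" "G $ 3"]
    unfolding extra_solution_def quadruple_even_part by blast
qed

text \<open>Linearly dependent coprime polynomials are constants, which a positive maximum degree
  excludes.\<close>

lemma independent_pair_of_poly_tuples:
  assumes F: "F \<in> poly_tuples d" and d: "d \<ge> 1"
  shows "independent_pair F"
proof -
  have cop: "is_unit p" if "p dvd F $ 0" "p dvd F $ 1" for p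
    using F that unfolding poly_tuples_def coprime_tuple_def all_2_iff by blast
  have deg: "degree (F $ 0) \<noteq> 0 \<or> degree (F $ 1) \<noteq> 0"
    using F d unfolding poly_tuples_def mem_Collect_eq max_degree_eq_iff ex_2_iff by auto
  show ?thesis
    unfolding independent_pair_def
  proof (intro allI impI, rule ccontr)
    fix a b assume e: "smult a (F $ 0) + smult b (F $ 1) = 0" and ab: "\<not> (a = 0 \<and> b = 0)"
    show False
    proof (cases "a = 0")
      case True
      then have "F $ 1 = 0" using e ab by simp
      then have "is_unit (F $ 0)" using cop by simp
      then have "degree (F $ 0) = 0" by (metis is_unit_iff_degree not_is_unit_0)
      then show False using deg \<open>F $ 1 = 0\<close> by simp
    next
      case False
      then have F0: "F $ 0 = smult (- b / a) (F $ 1)"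
        using arg_cong[OF e, of "smult (1 / a)"] by (simp add: smult_add_right eq_neg_iff_add_eq_0)
      have u: "is_unit (F $ 1)" by (rule cop) (simp_all only: F0 dvd_smult dvd_refl)
      then have "degree (F $ 1) = 0" by (metis is_unit_iff_degree not_is_unit_0)
      then show False using deg F0 by (metis degree_smult_le le_zero_eq)
    qed
  qed
qed

lemma collapse_point_of_extra_solution:
  assumes F: "F \<in> poly_tuples d" and d: "d \<ge> 1" and ex: "extra_solution d F"
  shows "proj_map F \<in> collapse_points d"
proof -
  obtain H K where HK: "degree H \<le> d" "degree K \<le> d"
      "wronskian H (F $ 0) + wronskian K (F $ 1) = 0" "\<not> trivial_solution F H K"
    using ex unfolding extra_solution_def by blast
  define G where "G = (\<lambda>t. quadruple F (smult t H) (smult t K))"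
  have G: "G t \<in> poly_tuples d" for t
    unfolding G_def using F HK by (intro quadruple_in_poly_tuples order_trans[OF degree_smult_le])
  have hor: "horizontal_tuple (G t)" for t
    unfolding G_def horizontal_quadruple_iff wronskian_smult_left
    using HK(3) by (metis smult_0_right smult_add_right)
  have full: "full (proj_map (G t))" if "t \<noteq> 0" for t
  proof -
    have "a = 0" if "combination a (G t) = 0" for a
    proof (rule ccontr)
      assume "a \<noteq> 0"
      \<comment> \<open>Moving the factor t from the odd components to the coefficients turns a
        relation for \<open>G t\<close> into one for the unscaled quadruple.\<close>
      let ?b = "\<chi> i. if i = 1 \<or> i = 3 then t * a $ i else a $ i"
      have "combination ?b (quadruple F H K) = combination a (G t)"
        by (simp add: combination_def sum_UNIV_4 G_def mult.commute)
      moreover have "?b \<noteq> 0" using \<open>a \<noteq> 0\<close> \<open>t \<noteq> 0\<close>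
        by (auto simp: Finite_Cartesian_Product.vec_eq_iff all_4_iff)
      ultimately have "trivial_solution F H K"
        using that by (intro trivial_solution_of_combination[OF independent_pair_of_poly_tuples[OF F d] HK(3)]) simp_all
      then show False using HK(4) by simp
    qed
    then show ?thesis using full_proj_map_iff[OF G] by blast
  qed
  have "continuous_on UNIV (\<lambda>t. coeff (G t $ i) k)" for i k
  proof -
    have "\<forall>i. continuous_on UNIV (\<lambda>t. coeff (G t $ i) k)"
      unfolding all_4_iff by (simp add: G_def) (intro conjI continuous_intros)
    then show ?thesis by blast
  qed
  from continuous_map_curry_compact_open[OF continuous_map_proj_map_family[OF G this]]
  have cont: "continuous_map euclidean (compact_open sphere2 cp_top) (\<lambda>t. proj_map (G t))" .
  have mem: "proj_map (G t) \<in> horizontal_Hol d" for t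
    unfolding horizontal_Hol_def using G hor by blast
  have G0: "cp_embed \<circ> proj_map F = proj_map (G 0)" by (simp add: cp_embed_proj_map[OF F] G_def)
  have "proj_map (G 0) \<in> subtopology (compact_open sphere2 cp_top) (horizontal_Hol d)
       closure_of {g \<in> horizontal_Hol d. full g}"
    unfolding in_closure_of
  proof (intro conjI allI impI)
    show "proj_map (G 0) \<in> topspace (subtopology (compact_open sphere2 cp_top) (horizontal_Hol d))"
      using mem proj_map_in_compact_open(2)[OF G] by simp
    fix T assume T: "proj_map (G 0) \<in> T \<and> openin (subtopology (compact_open sphere2 cp_top) (horizontal_Hol d)) T"
    then obtain S where S: "openin (compact_open sphere2 cp_top) S" "T = S \<inter> horizontal_Hol d"
      unfolding openin_subtopology by blast
    have "openin euclidean {t \<in> topspace euclidean. proj_map (G t) \<in> S}"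
      using cont S(1) by (rule openin_continuous_map_preimage)
    then have "open {t. proj_map (G t) \<in> S}" by simp
    moreover have "0 \<in> {t. proj_map (G t) \<in> S}" using T S(2) by simp
    ultimately obtain e where e: "e > 0" "ball 0 e \<subseteq> {t. proj_map (G t) \<in> S}" by (rule openE)
    have "complex_of_real (e / 2) \<in> ball 0 e" "complex_of_real (e / 2) \<noteq> 0" using e(1) by auto
    then have "proj_map (G (complex_of_real (e / 2))) \<in> S" "full (proj_map (G (complex_of_real (e / 2))))"
      using e(2) full by blast+
    then show "\<exists>y. y \<in> {g \<in> horizontal_Hol d. full g} \<and> y \<in> T" using mem S(2) by blast
  qed
  then show ?thesis using F G0 unfolding collapse_points_def Hol_def by auto
qed


section \<open>Collapse points have extra solutions\<close>

lemma norm_vector_smult: "norm (c *s (v :: complex ^ 'n)) = norm c * norm v"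
  by (simp add: norm_vec_def L2_set_right_distrib norm_mult)

text \<open>
  A scale-invariant way of saying that the lines through \<open>u\<close> and \<open>v\<close> are close, for large \<open>m\<close>.
\<close>
definition nearly_parallel :: "real \<Rightarrow> complex ^ 4 \<Rightarrow> complex ^ 4 \<Rightarrow> bool" where
  "nearly_parallel m u v \<longleftrightarrow> (\<forall>i j. norm (v $ i * u $ j - v $ j * u $ i) * m < norm v)"

lemma nearly_parallel_scale:
  assumes "c \<noteq> 0"
  shows "nearly_parallel m u (c *s v) \<longleftrightarrow> nearly_parallel m u v"
proof -
  have e: "norm ((c *s v) $ i * u $ j - (c *s v) $ j * u $ i) * m
      = norm c * (norm (v $ i * u $ j - v $ j * u $ i) * m)" for i j
    by (simp add: mult.assoc flip: right_diff_distrib norm_mult)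
  show ?thesis unfolding nearly_parallel_def norm_vector_smult e using assms by simp
qed

lemma open_nearly_parallel: "open {v. v \<noteq> 0 \<and> nearly_parallel m u v}"
proof -
  have "{v. v \<noteq> 0 \<and> nearly_parallel m u v} = {v. v \<noteq> 0} \<inter>
     (\<Inter>i\<in>UNIV. \<Inter>j\<in>UNIV. {v. norm (v $ i * u $ j - v $ j * u $ i) * m < norm v})"
    unfolding nearly_parallel_def by blast
  also have "open \<dots>"
    by (intro open_Int open_INT ballI open_Collect_neq open_Collect_less continuous_intros) auto
  finally show ?thesis .
qed

text \<open>Singletons are compact, so finitely many conditions on values define an open set of the
  compact-open topology; \<open>proj_map ?E\<close> meets them because the minors of a vector with
  itself vanish.\<close>

lemma collapse_point_approximation:
  fixes F :: "complex poly ^ 2" and m :: real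
  assumes F: "F \<in> poly_tuples d" and col: "proj_map F \<in> collapse_points d" and Z: "finite Z"
  obtains G where "G \<in> poly_tuples d" "horizontal_tuple G" "full (proj_map G)"
    "\<And>z. z \<in> Z \<Longrightarrow> nearly_parallel m (\<chi> i. poly (quadruple F 0 0 $ i) z) (\<chi> i. poly (G $ i) z)"
proof -
  let ?E = "quadruple F 0 0"
  have E: "?E \<in> poly_tuples d" using F by (intro quadruple_in_poly_tuples) auto
  define L where "L = (\<lambda>z. lines_with (nearly_parallel m (\<chi> i. poly (?E $ i) z)))"
  define S where "S = (\<Inter>z\<in>Z. {f. continuous_map sphere2 cp_top f \<and> f ` {Some z} \<subseteq> L z})
    \<inter> topspace (compact_open sphere2 cp_top)"
  have "openin (compact_open sphere2 cp_top) S"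
    unfolding S_def
  proof (rule openin_INT[OF Z])
    fix z
    have "openin cp_top (L z)"
      unfolding L_def by (intro openin_lines_with nearly_parallel_scale open_nearly_parallel)
    then show "openin (compact_open sphere2 cp_top)
        {f. continuous_map sphere2 cp_top f \<and> f ` {Some z} \<subseteq> L z}"
      unfolding compact_open_def
      by (intro topology_generated_by_Basis CollectI exI[of _ "{Some z}"] exI[of _ "L z"]) auto
  qed
  then have "openin (subtopology (compact_open sphere2 cp_top) (horizontal_Hol d)) (S \<inter> horizontal_Hol d)"
    unfolding openin_subtopology by blast
  moreover have "proj_map ?E \<in> S"
  proof -
    have "proj_map ?E (Some z) \<in> L z" for z
      unfolding L_def proj_map_Some
        span_in_lines_with_iff[of "nearly_parallel _ _", OF nearly_parallel_scale poly_tuples_value_nonzero[OF E], simplified]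
      using poly_tuples_value_nonzero[OF E, of z] by (simp add: nearly_parallel_def mult.commute)
    then show ?thesis unfolding S_def using proj_map_in_compact_open[OF E] by simp
  qed
  moreover have "proj_map ?E \<in> subtopology (compact_open sphere2 cp_top) (horizontal_Hol d)
       closure_of {g \<in> horizontal_Hol d. full g}"
    using col unfolding collapse_points_def cp_embed_proj_map[OF F, symmetric] by simp
  moreover from this have "proj_map ?E \<in> horizontal_Hol d"
    unfolding in_closure_of by simp
  ultimately obtain g where g: "g \<in> horizontal_Hol d" "full g" "g \<in> S"
    unfolding in_closure_of by blast
  then obtain G where G: "g = proj_map G" "G \<in> poly_tuples d" "horizontal_tuple G"
    unfolding horizontal_Hol_def by blast
  show ?thesis
  proof (rule that[OF G(2,3)])
    show "full (proj_map G)" using g G by simp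
    fix z assume "z \<in> Z"
    then have "proj_map G (Some z) \<in> L z" using g(3) G(1) unfolding S_def by auto
    then show "nearly_parallel m (\<chi> i. poly (?E $ i) z) (\<chi> i. poly (G $ i) z)"
      unfolding L_def proj_map_Some
      using span_in_lines_with_iff[of "nearly_parallel _ _", OF nearly_parallel_scale poly_tuples_value_nonzero[OF G(2)]]
      by blast
  qed
qed

definition scale_tuple :: "complex \<Rightarrow> complex poly ^ 'n \<Rightarrow> complex poly ^ 'n" where
  "scale_tuple a F = (\<chi> i. smult a (F $ i))"

lemma scale_tuple_nth [simp]: "scale_tuple a F $ i = smult a (F $ i)"
  by (simp add: scale_tuple_def)

lemma independent_pair_scale:
  assumes "independent_pair F" "a \<noteq> 0"
  shows "independent_pair (scale_tuple a F)"
  using assms unfolding independent_pair_def by fastforce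

lemma extra_solution_scale:
  assumes "extra_solution d F" "a \<noteq> 0"
  shows "extra_solution d (scale_tuple a F)"
proof -
  obtain H K where HK: "degree H \<le> d" "degree K \<le> d"
      "wronskian H (F $ 0) + wronskian K (F $ 1) = 0" "\<not> trivial_solution F H K"
    using assms unfolding extra_solution_def by blast
  have "wronskian H (scale_tuple a F $ 0) + wronskian K (scale_tuple a F $ 1) = 0"
    using HK(3) by (simp add: wronskian_smult_right flip: smult_add_right)
  moreover have "\<not> trivial_solution (scale_tuple a F) H K"
    using HK(4) unfolding trivial_solution_def by (auto simp: smult_smult)
  ultimately show ?thesis using HK(1,2) unfolding extra_solution_def by blast
qed

text \<open>Fixing the scalar bounds all coefficients and keeps their limits from vanishing
  together. The conclusions needed later survive rescaling.\<close>

lemma normalized_approximation: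
  fixes F :: "complex poly ^ 2" and m :: real
  assumes F: "F \<in> poly_tuples d" and col: "proj_map F \<in> collapse_points d" and Z: "finite Z"
  obtains G where "\<And>i. degree (G $ i) \<le> d" "independent_pair (even_part G)" "extra_solution d (even_part G)"
    "(\<Sum>i\<in>UNIV. \<Sum>s\<le>d. norm (coeff (G $ i) s)) = 1"
    "\<And>z. z \<in> Z \<Longrightarrow> nearly_parallel m (\<chi> i. poly (quadruple F 0 0 $ i) z) (\<chi> i. poly (G $ i) z)"
proof -
  obtain G where G: "G \<in> poly_tuples d" "horizontal_tuple G" "full (proj_map G)"
    and np: "\<And>z. z \<in> Z \<Longrightarrow> nearly_parallel m (\<chi> i. poly (quadruple F 0 0 $ i) z) (\<chi> i. poly (G $ i) z)"
    using collapse_point_approximation[OF F col Z, of m] by metis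
  define N where "N = (\<Sum>i\<in>UNIV. \<Sum>s\<le>d. norm (coeff (G $ i) s))"
  have "N \<noteq> 0"
  proof
    assume "N = 0"
    then have "coeff (G $ i) d = 0" for i
      unfolding N_def by (simp add: sum_nonneg_eq_0_iff sum_nonneg)
    then show False using poly_tuples_leading_nonzero[OF G(1)]
      by (simp add: Finite_Cartesian_Product.vec_eq_iff)
  qed
  moreover have "N \<ge> 0" unfolding N_def by (intro sum_nonneg) auto
  ultimately have N: "N > 0" by simp
  define a where "a = complex_of_real (1 / N)"
  have a: "a \<noteq> 0" "norm a = 1 / N" using N by (simp_all add: a_def norm_divide)
  let ?G = "scale_tuple a G"
  have even: "even_part ?G = scale_tuple a (even_part G)"
    by (simp add: Finite_Cartesian_Product.vec_eq_iff all_2_iff)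
  show ?thesis
  proof (rule that[of ?G])
    show "degree (?G $ i) \<le> d" for i
      using poly_tuples_degree_le[OF G(1)] a(1) by simp
    show "independent_pair (even_part ?G)" "extra_solution d (even_part ?G)"
      unfolding even using full_horizontal_even_part[OF G] a(1) independent_pair_scale extra_solution_scale
      by blast+
    have "(\<Sum>i\<in>UNIV. \<Sum>s\<le>d. norm (coeff (?G $ i) s)) = norm a * N"
      by (simp add: N_def norm_mult sum_distrib_left)
    then show "(\<Sum>i\<in>UNIV. \<Sum>s\<le>d. norm (coeff (?G $ i) s)) = 1" using a(2) N by simp
    fix z assume "z \<in> Z"
    have "(\<chi> i. poly (?G $ i) z) = a *s (\<chi> i. poly (G $ i) z)"
      by (simp add: Finite_Cartesian_Product.vec_eq_iff)
    then show "nearly_parallel m (\<chi> i. poly (quadruple F 0 0 $ i) z) (\<chi> i. poly (?G $ i) z)"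
      using np[OF \<open>z \<in> Z\<close>] nearly_parallel_scale[OF a(1)] by simp
  qed
qed

section \<open>Passing to the limit of normalised coefficients\<close>

lemma bounded_family_convergent_subsequence:
  fixes f :: "nat \<Rightarrow> 'i \<Rightarrow> complex"
  assumes "finite I" "\<And>n i. i \<in> I \<Longrightarrow> norm (f n i) \<le> B"
  shows "\<exists>r l. strict_mono r \<and> (\<forall>i\<in>I. (\<lambda>n. f (r n) i) \<longlonglongrightarrow> l i)"
  using assms
proof (induction I rule: finite_induct)
  case empty
  show ?case by (intro exI[of _ id] exI[of _ "\<lambda>_. 0"] conjI strict_mono_id) simp
next
  case (insert j I)
  have "\<exists>r l. strict_mono r \<and> (\<forall>i\<in>I. (\<lambda>n. f (r n) i) \<longlonglongrightarrow> l i)"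
    using insert.IH insert.prems by blast
  then obtain r l where r: "strict_mono (r :: nat \<Rightarrow> nat)" "\<And>i. i \<in> I \<Longrightarrow> (\<lambda>n. f (r n) i) \<longlonglongrightarrow> l i"
    by blast
  have "\<forall>n. f (r n) j \<in> cball 0 B" using insert.prems by simp
  then obtain lj q where q: "strict_mono q" "((\<lambda>n. f (r n) j) \<circ> q) \<longlonglongrightarrow> lj"
    using compact_cball[of "0::complex" B] unfolding compact_def by metis
  have "(\<lambda>n. f ((r \<circ> q) n) i) \<longlonglongrightarrow> (l(j := lj)) i" if "i \<in> insert j I" for i
  proof (cases "i = j")
    case True
    then show ?thesis using q(2) by (simp add: o_def)
  next
    case False
    then have "i \<in> I" using that by simp
    from LIMSEQ_subseq_LIMSEQ[OF r(2)[OF this] q(1)] show ?thesis using False by (simp add: o_def)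
  qed
  then show ?case using strict_mono_o[OF r(1) q(1)] by blast
qed

lemma tendsto_mv_eval:
  assumes "\<And>v. v \<in> mv_vars p \<Longrightarrow> (\<lambda>n. x n v) \<longlonglongrightarrow> y v"
  shows "(\<lambda>n. mv_eval p (x n)) \<longlonglongrightarrow> mv_eval p y"
  unfolding mv_eval_def using assms
  by (intro tendsto_sum tendsto_mult tendsto_const tendsto_prod tendsto_power) (auto simp: mv_vars_def)

text \<open>Coprimality gives both even components of \<open>C\<close> a common cofactor
  \<open>h\<close>; as one component of \<open>F\<close> already has degree d, \<open>h\<close> is
  constant. The odd components vanish against \<open>F $ 0\<close>.\<close>

lemma parallel_tuple_is_multiple:
  fixes F :: "complex poly ^ 2" and C :: "complex poly ^ 4"
  assumes F: "F \<in> poly_tuples d" and d: "d \<ge> 1" and C: "\<And>i. degree (C $ i) \<le> d" "C \<noteq> 0"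
    and par: "\<And>i j. C $ i * quadruple F 0 0 $ j = C $ j * quadruple F 0 0 $ i"
  obtains a where "a \<noteq> 0" "even_part C = scale_tuple a F"
proof -
  have F0: "F $ 0 \<noteq> 0"
  proof
    assume "F $ 0 = 0"
    then have "smult 1 (F $ 0) + smult 0 (F $ 1) = 0" by simp
    then show False using independent_pair_of_poly_tuples[OF F d] unfolding independent_pair_def
      by (metis zero_neq_one)
  qed
  have odd: "C $ 1 = 0" "C $ 3 = 0" using par[of 1 0] par[of 3 0] F0 by auto
  have eq: "C $ 0 * F $ 1 = C $ 2 * F $ 0" using par[of 0 2] by simp
  have "coprime (F $ 0) (F $ 1)"
    using F unfolding poly_tuples_def coprime_tuple_def all_2_iff by (intro coprimeI) blast
  moreover have "F $ 0 dvd C $ 0 * F $ 1" unfolding eq by simp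
  ultimately have "F $ 0 dvd C $ 0" by (simp add: coprime_dvd_mult_left_iff)
  then obtain h where h: "C $ 0 = F $ 0 * h" by (rule dvdE)
  have "F $ 0 * (h * F $ 1) = F $ 0 * C $ 2" using eq h by (simp add: ac_simps)
  then have h2: "C $ 2 = F $ 1 * h" using F0 by (simp add: mult.commute)
  have h0: "h \<noteq> 0"
  proof
    assume "h = 0"
    then have "C = 0" using h h2 odd by (simp add: Finite_Cartesian_Product.vec_eq_iff all_4_iff)
    then show False using C(2) by simp
  qed
  obtain i where i: "degree (F $ i) = d" using F unfolding poly_tuples_def using max_degree_eq_iff by blast
  then have "F $ i \<noteq> 0" using d by auto
  have "degree (F $ i * h) \<le> d"
    using C(1)[of 0] C(1)[of 2] all_2_iff[of "\<lambda>i. degree (F $ i * h) \<le> d"] h h2 by metis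
  then have "degree h = 0" using degree_mult_eq[OF \<open>F $ i \<noteq> 0\<close> h0] i by simp
  then obtain a where a: "h = [:a:]" by (rule degree_eq_zeroE)
  have "even_part C = scale_tuple a F"
    by (simp add: Finite_Cartesian_Product.vec_eq_iff all_2_iff h h2 a)
  then show ?thesis using that h0 a by auto
qed

lemma extra_solution_of_collapse_point:
  assumes F: "F \<in> poly_tuples d" and d: "d \<ge> 1" and col: "proj_map F \<in> collapse_points d"
  shows "extra_solution d F"
proof -
  let ?E = "quadruple F 0 0"
  \<comment> \<open>The \<open>2 \<times> 2\<close> minors below are polynomials of degree at most \<open>2 d\<close>, so \<open>2 d + 1\<close> points detect them.\<close>
  define Z where "Z = (of_nat ` {..2 * d} :: complex set)"
  have Z: "finite Z" "card Z = 2 * d + 1"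
    unfolding Z_def by (simp_all add: card_image inj_on_def)
  have "\<exists>G. (\<forall>i. degree (G $ i) \<le> d) \<and> independent_pair (even_part G) \<and> extra_solution d (even_part G) \<and>
    (\<Sum>i\<in>UNIV. \<Sum>s\<le>d. norm (coeff (G $ i) s)) = 1 \<and>
    (\<forall>z\<in>Z. nearly_parallel (real (Suc n)) (\<chi> i. poly (?E $ i) z) (\<chi> i. poly (G $ i) z))" for n
    using normalized_approximation[OF F col Z(1), of "real (Suc n)"] by metis
  then obtain G where G: "\<And>n i. degree (G n $ i) \<le> d" "\<And>n. independent_pair (even_part (G n))"
      "\<And>n. extra_solution d (even_part (G n))" "\<And>n. (\<Sum>i\<in>UNIV. \<Sum>s\<le>d. norm (coeff (G n $ i) s)) = 1"
      "\<And>n z. z \<in> Z \<Longrightarrow> nearly_parallel (real (Suc n)) (\<chi> i. poly (?E $ i) z) (\<chi> i. poly (G n $ i) z)"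
    by metis
  have "norm (coeff (G n $ i) s) \<le> 1" if "s \<le> d" for n i s
  proof -
    have "norm (coeff (G n $ i) s) \<le> (\<Sum>s\<le>d. norm (coeff (G n $ i) s))"
      using that by (intro member_le_sum) auto
    also have "\<dots> \<le> (\<Sum>i\<in>UNIV. \<Sum>s\<le>d. norm (coeff (G n $ i) s))"
      by (intro member_le_sum[of i UNIV "\<lambda>i. \<Sum>s\<le>d. norm (coeff (G n $ i) s)"] sum_nonneg) auto
    finally show ?thesis using G(4) by simp
  qed
  then have "\<exists>r l. strict_mono r \<and>
      (\<forall>x\<in>UNIV \<times> {..d}. (\<lambda>n. (\<lambda>(i, s). coeff (G (r n) $ i) s) x) \<longlonglongrightarrow> l x)"
    by (intro bounded_family_convergent_subsequence[where f = "\<lambda>n (i, s). coeff (G n $ i) s"]) auto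
  then obtain r l where r: "strict_mono r"
      and l: "\<And>i s. s \<le> d \<Longrightarrow> (\<lambda>n. coeff (G (r n) $ i) s) \<longlonglongrightarrow> l (i, s)"
    by fastforce
  \<comment> \<open>The limit tuple; nothing is known yet about its coprimality or exact
    degree.\<close>
  define C :: "complex poly ^ 4" where "C = (\<chi> i. \<Sum>s\<le>d. monom (l (i, s)) s)"
  have C: "degree (C $ i) \<le> d" for i
    unfolding C_def by (auto intro!: degree_sum_le order_trans[OF degree_monom_le])
  have Ccoeff: "coeff (C $ i) s = l (i, s)" if "s \<le> d" for i s
    using that by (simp add: C_def coeff_sum coeff_monom)
  have lim: "(\<lambda>n. coeff (G (r n) $ i) s) \<longlonglongrightarrow> coeff (C $ i) s" if "s \<le> d" for i s
    using l[OF that] Ccoeff[OF that] by simp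
  have "(\<lambda>n. \<Sum>i\<in>UNIV. \<Sum>s\<le>d. norm (coeff (G (r n) $ i) s)) \<longlonglongrightarrow> (\<Sum>i\<in>UNIV. \<Sum>s\<le>d. norm (coeff (C $ i) s))"
    using lim by (intro tendsto_sum tendsto_norm) auto
  then have "(\<Sum>i\<in>UNIV. \<Sum>s\<le>d. norm (coeff (C $ i) s)) = 1"
    unfolding G(4) by (simp add: LIMSEQ_const_iff)
  then have "C \<noteq> 0" by auto
  have limp: "(\<lambda>n. poly (G (r n) $ i) z) \<longlonglongrightarrow> poly (C $ i) z" for i z
    unfolding poly_eq_sum_le[OF G(1)] poly_eq_sum_le[OF C]
    using lim by (intro tendsto_sum tendsto_mult tendsto_const) auto
  have minor: "poly (C $ i * ?E $ j - C $ j * ?E $ i) z = 0" if z: "z \<in> Z" for i j z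
  proof -
    define M where "M = (\<lambda>n. poly (G (r n) $ i) z * poly (?E $ j) z - poly (G (r n) $ j) z * poly (?E $ i) z)"
    define v where "v = (\<lambda>n. (\<chi> i. poly (G (r n) $ i) z) :: complex ^ 4)"
    have "M \<longlonglongrightarrow> poly (C $ i * ?E $ j - C $ j * ?E $ i) z"
      unfolding M_def poly_diff poly_mult by (intro tendsto_diff tendsto_mult tendsto_const limp)
    moreover have "M \<longlonglongrightarrow> 0"
    proof (rule Lim_null_comparison)
      \<comment> \<open>The vectors \<open>v n\<close> converge, so their norms stay bounded and the
        growing factor forces the minors to 0.\<close>
      have "norm (M n) * real (Suc (r n)) < norm (v n)" for n
        using G(5)[OF z, of "r n"] unfolding nearly_parallel_def M_def v_def by simp
      then have "norm (M n) \<le> norm (v n) * inverse (real (Suc (r n)))" for n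
        by (simp add: field_simps less_imp_le)
      then show "\<forall>\<^sub>F n in sequentially. norm (M n) \<le> norm (v n) * inverse (real (Suc (r n)))" by simp
      have "v \<longlonglongrightarrow> (\<chi> i. poly (C $ i) z)"
        unfolding v_def by (intro vec_tendstoI) (simp add: limp)
      moreover have "(\<lambda>n. inverse (real (Suc (r n)))) \<longlonglongrightarrow> 0"
        using LIMSEQ_subseq_LIMSEQ[OF LIMSEQ_inverse_real_of_nat r] by (simp add: o_def)
      ultimately have "(\<lambda>n. norm (v n) * inverse (real (Suc (r n)))) \<longlonglongrightarrow> norm (\<chi> i. poly (C $ i) z) * 0"
        by (intro tendsto_mult tendsto_norm)
      then show "(\<lambda>n. norm (v n) * inverse (real (Suc (r n)))) \<longlonglongrightarrow> 0" by simp
    qed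
    ultimately show ?thesis by (rule LIMSEQ_unique)
  qed
  have E: "degree (?E $ i) \<le> d" for i
    using F by (intro poly_tuples_degree_le quadruple_in_poly_tuples) auto
  have par: "C $ i * ?E $ j = C $ j * ?E $ i" for i j
  proof (rule ccontr)
    assume "\<not> ?thesis"
    then have nz: "C $ i * ?E $ j - C $ j * ?E $ i \<noteq> 0" by simp
    have "degree (C $ i * ?E $ j) \<le> 2 * d" "degree (C $ j * ?E $ i) \<le> 2 * d"
      using degree_mult_le[of "C $ i" "?E $ j"] degree_mult_le[of "C $ j" "?E $ i"] C[of i] C[of j] E[of i] E[of j]
      by linarith+
    then have "degree (C $ i * ?E $ j - C $ j * ?E $ i) \<le> 2 * d" by (intro degree_diff_le)
    moreover have "card Z \<le> card {z. poly (C $ i * ?E $ j - C $ j * ?E $ i) z = 0}"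
      using minor nz by (intro card_mono poly_roots_finite) auto
    ultimately show False
      using card_poly_roots_bound[OF nz] Z(2) by linarith
  qed
  obtain a where a: "a \<noteq> 0" "even_part C = scale_tuple a F"
    using parallel_tuple_is_multiple[OF F d C \<open>C \<noteq> 0\<close> par] by blast
  obtain P where P: "\<And>p. p \<in> P \<Longrightarrow> mv_vars p \<subseteq> UNIV \<times> {..d}"
    "\<And>F. independent_pair F \<Longrightarrow> (\<And>k. degree (F $ k) \<le> d) \<Longrightarrow>
       extra_solution d F \<longleftrightarrow> (\<forall>p\<in>P. mv_eval p (coefficients F) = 0)"
    using extra_solution_algebraic[OF d] by metis
  have deg_even: "degree (even_part A $ k) \<le> d" if "\<And>i. degree (A $ i) \<le> d" for A k
    using that by (simp add: even_part_def)
  \<comment> \<open>The closed condition: each polynomial vanishes along the sequence, hence at the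
    limit of the coefficients.\<close>
  have "mv_eval p (coefficients (even_part C)) = 0" if p: "p \<in> P" for p
  proof -
    have "(\<lambda>n. mv_eval p (coefficients (even_part (G (r n))))) \<longlonglongrightarrow> mv_eval p (coefficients (even_part C))"
    proof (rule tendsto_mv_eval)
      fix v assume "v \<in> mv_vars p"
      then obtain i s where "v = (i, s)" "s \<le> d" using P(1)[OF p] by auto
      then show "(\<lambda>n. coefficients (even_part (G (r n))) v) \<longlonglongrightarrow> coefficients (even_part C) v"
        using lim by (simp add: even_part_def)
    qed
    moreover have "mv_eval p (coefficients (even_part (G (r n)))) = 0" for n
      using P(2)[of "even_part (G (r n))", OF G(2) deg_even[OF G(1)]] G(3) p by blast
    ultimately show ?thesis by (simp add: LIMSEQ_const_iff)
  qed
  moreover have "independent_pair (even_part C)"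
    unfolding a(2) using independent_pair_scale[OF independent_pair_of_poly_tuples[OF F d] a(1)] .
  ultimately have "extra_solution d (even_part C)" using P(2) deg_even[OF C] by blast
  then have "extra_solution d (scale_tuple (inverse a) (scale_tuple a F))"
    unfolding a(2) using a(1) by (rule extra_solution_scale[OF _ nonzero_imp_inverse_nonzero])
  moreover have "scale_tuple (inverse a) (scale_tuple a F) = F"
    using a(1) by (simp add: Finite_Cartesian_Product.vec_eq_iff)
  ultimately show ?thesis by simp
qed

section \<open>Emptiness, non-emptiness and properness\<close>

lemma collapse_points_empty:
  assumes "d \<le> 2"
  shows "collapse_points d = {}"
proof -
  have none: "{g \<in> horizontal_Hol d. full g} = {}"
    using no_full_of_degree_le_2 assms unfolding horizontal_Hol_def by blast
  show ?thesis unfolding collapse_points_def none by simp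
qed

section \<open>A collapse point in every degree at least 3\<close>

definition binomial_pair :: "nat \<Rightarrow> complex poly ^ 2" where
  "binomial_pair d = (\<chi> i. if i = 0 then 1 + monom 1 d else monom 1 1)"

lemma binomial_pair_in_poly_tuples:
  assumes "d \<ge> 2"
  shows "binomial_pair d \<in> poly_tuples d"
proof -
  have deg: "degree (1 + monom 1 d :: complex poly) = d"
    using assms by (simp add: degree_add_eq_right degree_monom_eq)
  have "is_unit p" if "p dvd 1 + monom 1 d" "p dvd monom (1::complex) 1" for p
  proof -
    have "p dvd monom 1 1 * monom 1 (d - 1)" using that(2) by (rule dvd_mult2)
    also have "monom 1 1 * monom 1 (d - 1) = (monom 1 d :: complex poly)"
      using assms by (simp add: mult_monom)
    finally show ?thesis using that(1) by (simp add: dvd_add_left_iff)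
  qed
  then show ?thesis
    unfolding poly_tuples_def mem_Collect_eq coprime_tuple_def max_degree_eq_iff all_2_iff ex_2_iff
    using assms deg by (auto simp: binomial_pair_def degree_monom_eq)
qed

lemma extra_solution_binomial_pair:
  assumes "d \<ge> 3"
  shows "extra_solution d (binomial_pair d)"
proof -
  \<comment> \<open>The extra solution is (c z^d, z^(d-1)). Its Wronskians with 1 + z^d and z are -
    d c z^(d-1) and (2 - d) z^(d-1), which fixes c; it is nonzero because d is not 2.\<close>
  define c where "c = (2 - of_nat d) / (of_nat d :: complex)"
  have d0: "of_nat d \<noteq> (0::complex)" "of_nat d \<noteq> (2::complex)"
    using assms of_nat_eq_iff[where 'a = complex, of d 2] by auto
  have c: "of_nat d * c = 2 - of_nat d" "c \<noteq> 0" using d0 by (auto simp: c_def)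
  obtain e where e: "d = Suc (Suc e)"
    using assms by (intro that[of "d - 2"]) simp
  have "wronskian (monom c d) (1 + monom 1 d) = - pderiv (monom c d)"
  proof -
    have "wronskian (monom c d) (1 + monom 1 d) = wronskian (monom c d) 1 + wronskian (smult c (monom 1 d)) (monom 1 d)"
      by (simp add: wronskian_add_right smult_monom)
    also have "\<dots> = - pderiv (monom c d)"
      unfolding wronskian_smult_left by (simp add: wronskian_def)
    finally show ?thesis .
  qed
  moreover have "wronskian (monom 1 (d - 1)) (monom 1 1) = monom (2 - of_nat d) (d - 1)"
    by (simp add: wronskian_def e pderiv_monom mult_monom diff_monom)
  ultimately have "wronskian (monom c d) (binomial_pair d $ 0) + wronskian (monom 1 (d - 1)) (binomial_pair d $ 1) = 0"
    using c(1) by (simp add: binomial_pair_def pderiv_monom)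
  moreover have "\<not> trivial_solution (binomial_pair d) (monom c d) (monom 1 (d - 1))"
  proof
    assume "trivial_solution (binomial_pair d) (monom c d) (monom 1 (d - 1))"
    then obtain a b where "monom c d = smult a (1 + monom 1 d) + smult b (monom 1 1)"
      unfolding trivial_solution_def by (auto simp: binomial_pair_def)
    then have "coeff (monom c d) k = coeff (smult a (1 + monom 1 d) + smult b (monom 1 1)) k" for k by simp
    \<comment> \<open>A trivial \<open>H\<close> has equal coefficients at 0 and d, whereas c z^d
      has 0 and c.\<close>
    from this[of 0] this[of d] have "a = 0" "c = a" using assms by (simp_all add: coeff_monom)
    then show False using c(2) by simp
  qed
  ultimately show ?thesis
    unfolding extra_solution_def using degree_monom_le[of c d] degree_monom_le[of "1::complex" "d - 1"]
    by (intro exI[of _ "monom c d"] exI[of _ "monom 1 (d - 1)"]) auto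
qed

section \<open>A map that is not a collapse point\<close>

definition power_pair :: "nat \<Rightarrow> complex poly ^ 2" where
  "power_pair d = (\<chi> i. if i = 0 then 1 else monom 1 d)"

lemma power_pair_in_poly_tuples: "power_pair d \<in> poly_tuples d"
  unfolding poly_tuples_def mem_Collect_eq coprime_tuple_def max_degree_eq_iff all_2_iff ex_2_iff
  by (auto simp: power_pair_def degree_monom_eq)

text \<open>For monomials the equation decouples into t H_t = (2d - t) K_(t-d), the right side being
  0 for t < d. Only H_0, H_d = K_0 and K_d stay free, which are the three trivial
  parameters.\<close>

lemma no_extra_solution_power_pair:
  assumes d: "d \<ge> 1"
  shows "\<not> extra_solution d (power_pair d)"
proof
  assume "extra_solution d (power_pair d)"
  then obtain H K where HK: "degree H \<le> d" "degree K \<le> d"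
      "wronskian H 1 + wronskian K (monom 1 d) = 0" "\<not> trivial_solution (power_pair d) H K"
    unfolding extra_solution_def by (auto simp: power_pair_def)
  have cK: "coeff (wronskian K (monom 1 d)) r = (if Suc r < d then 0 else (2 * of_nat d - of_nat (Suc r)) * coeff K (Suc r - d))" for r
  proof -
    obtain e where e: "d = Suc e" using d by (cases d) auto
    have w: "wronskian K (monom 1 d) = monom (of_nat d) e * K - monom 1 d * pderiv K"
      by (simp add: wronskian_def pderiv_monom e mult.commute)
    consider "r < e" | "r = e" | k where "r = Suc e + k"
      by (metis less_iff_Suc_add linorder_neqE_nat add_Suc)
    then show ?thesis
      unfolding w coeff_diff by cases (simp_all add: coeff_monom_mult coeff_pderiv e ring_distribs)
  qed
  have key: "of_nat t * coeff H t = (if t < d then 0 else (2 * of_nat d - of_nat t) * coeff K (t - d))" if "t \<ge> 1" for t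
  proof -
    define r where "r = t - 1"
    have r: "t = Suc r" using that by (simp add: r_def)
    have "coeff (wronskian H 1) r = - (of_nat t * coeff H t)"
      by (simp add: wronskian_def coeff_pderiv r)
    then show ?thesis
      using arg_cong[OF HK(3), of "\<lambda>p. coeff p r"] unfolding coeff_add cK by (simp add: r split: if_splits)
  qed
  have "coeff H d = coeff K 0" using key[of d] d by simp
  have H: "coeff H t = 0" if "t \<noteq> 0" "t \<noteq> d" for t
    using key[of t] HK(1) that by (cases "t < d") (auto simp: coeff_eq_0)
  have K: "coeff K t = 0" if "t \<noteq> 0" "t \<noteq> d" for t
  proof (cases "t < d")
    case True
    \<comment> \<open>Index d + t exceeds d, so the coefficient of \<open>H\<close> there is zero,
      while the factor d - t is not.\<close>
    have "(of_nat d - of_nat t) * coeff K t = 0"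
      using key[of "d + t"] H[of "d + t"] that d by simp
    then show ?thesis using True by simp
  qed (use HK(2) that in \<open>simp add: coeff_eq_0\<close>)
  have "H = smult (coeff H 0) 1 + smult (coeff K 0) (monom 1 d)"
  proof (rule poly_eqI)
    fix n
    consider "n = 0" | "n = d" "n \<noteq> 0" | "n \<noteq> 0" "n \<noteq> d" by blast
    then show "coeff H n = coeff (smult (coeff H 0) 1 + smult (coeff K 0) (monom 1 d)) n"
      using H \<open>coeff H d = coeff K 0\<close> d by cases (simp_all add: coeff_pCons split: nat.splits)
  qed
  moreover have "K = smult (coeff K 0) 1 + smult (coeff K d) (monom 1 d)"
  proof (rule poly_eqI)
    fix n
    consider "n = 0" | "n = d" "n \<noteq> 0" | "n \<noteq> 0" "n \<noteq> d" by blast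
    then show "coeff K n = coeff (smult (coeff K 0) 1 + smult (coeff K d) (monom 1 d)) n"
      using K d by cases (simp_all add: coeff_pCons split: nat.splits)
  qed
  ultimately show False using HK(4) unfolding trivial_solution_def power_pair_def by auto
qed

theorem mainTheorem6:
  fixes d :: nat
  assumes "d \<ge> 1"
  shows "(collapse_points d \<noteq> {} \<longleftrightarrow> d \<ge> 3) \<and>
         (d \<ge> 3 \<longrightarrow> collapse_points d \<noteq> {} \<and> collapse_points d \<subset> Hol d \<and>
            algebraic_subvariety d (collapse_points d))"
proof -
  \<comment> \<open>This holds for every presenting tuple, so the set equality below needs no
    uniqueness of presentations.\<close>
  have iff: "proj_map F \<in> collapse_points d \<longleftrightarrow> extra_solution d F" if "F \<in> poly_tuples d" for F
    using that assms collapse_point_of_extra_solution extra_solution_of_collapse_point by blast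
  have Hol: "collapse_points d \<subseteq> Hol d" unfolding collapse_points_def by blast
  have "collapse_points d \<noteq> {}" if "d \<ge> 3"
    using iff[OF binomial_pair_in_poly_tuples] extra_solution_binomial_pair that by fastforce
  moreover have "collapse_points d = {}" if "\<not> d \<ge> 3"
    using that by (intro collapse_points_empty) simp
  moreover have "collapse_points d \<subset> Hol d"
  proof -
    have "proj_map (power_pair d) \<notin> collapse_points d"
      using iff[OF power_pair_in_poly_tuples] no_extra_solution_power_pair[OF assms] by blast
    moreover have "proj_map (power_pair d) \<in> Hol d"
      unfolding Hol_def using power_pair_in_poly_tuples by blast
    ultimately show ?thesis using Hol by blast
  qed
  moreover have "algebraic_subvariety d (collapse_points d)"
  proof -
    obtain P where P: "finite P" "\<And>p. p \<in> P \<Longrightarrow> mv_vars p \<subseteq> UNIV \<times> {..d} \<and> (\<exists>k. mv_homogeneous k p)"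
      "\<And>F. independent_pair F \<Longrightarrow> (\<And>k. degree (F $ k) \<le> d) \<Longrightarrow>
         extra_solution d F \<longleftrightarrow> (\<forall>p\<in>P. mv_eval p (coefficients F) = 0)"
      using extra_solution_algebraic[OF assms] by metis
    have "extra_solution d F \<longleftrightarrow> (\<forall>p\<in>P. mv_eval p (coefficients F) = 0)" if "F \<in> poly_tuples d" for F
      using P(3) independent_pair_of_poly_tuples[OF that assms] poly_tuples_degree_le[OF that] by blast
    then have "collapse_points d = {proj_map F | F. F \<in> poly_tuples d \<and> (\<forall>p\<in>P. mv_eval p (coefficients F) = 0)}"
      using iff Hol unfolding Hol_def by blast
    then show ?thesis
      unfolding algebraic_subvariety_def using P(1,2) by (intro exI[of _ P] conjI ballI) simp_all
  qed
  ultimately show ?thesis by blast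
qed

end
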